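(* Let $h:\mathbb{R}_{\geq 0}\to\mathbb{R}_{\geq 0}$ be strictly increasing with $h(0)=0$ and $h(n)\in\mathbb{Z}$ for all $n\in\mathbb{Z}_{\ge0}$, and let $p_h$ be defined by $\sum_{n=0}^{\infty} p_h(n)z^n=\prod_{n=1}^{\infty}(1-z^{h(n)})^{-1}$. Let $N$ be a positive integer and $c>0$, and let $\mathbb{L}_c=\{s\in\mathbb{C}:\Re s=c\}$. For $s\in\mathbb{L}_c$ and $k\ge1$ define $$ w'_k(s)=\int_{0}^{\infty} e^{-s k h(x)}\,dx, \qquad \lambda(s)=\sum_{k=1}^{N}\frac{w'_k(s)}{k}. $$ Suppose there exist $\alpha, D>0$ such that $|w'_1(s)|\le D|s|^{-\alpha}$ for all $s\in\mathbb{L}_c$. Then for every $x>0$ the limit $$ \varphi_h(x)=\frac{1}{2\pi i}\lim_{T\to\infty}\int_{c-iT}^{c+iT}\frac{1}{s}\exp(\lambda(s))\,e^{xs}\,ds $$ exists and is a real number, and $$ e^{-1}N^{-1}\varphi_h(N)\le \sum_{n=0}^{N}p_h(n)\le \varphi_h(N). $$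
   Context: The integral $\int_c^{c+iT}$-type integrals are taken along the vertical segment from $c-iT$ to $c+iT$. $p_h(n)$ is the number of ways to write $n$ as a sum of elements of $\{h(i): i\in\mathbb{Z}_{\ge1}\}$ in ascending order. *)

theory Defs
  imports "HOL-Complex_Analysis.Complex_Analysis"
begin

text \<open>
  The generating function of the partition function \<open>p\<^sub>h\<close>, as an infinite product of formal power
  series (convergence is in the metric of the type \<open>fps\<close>, i.e. coefficientwise stabilisation).
  The index is shifted because the product starts at \<open>h 1\<close>; the values of \<open>h\<close> on the naturals
  are assumed to be nonnegative integers, so \<open>nat \<lfloor>_\<rfloor>\<close> is only a coercion.
\<close>

definition partition_fps :: "(real \<Rightarrow> real) \<Rightarrow> real fps" where
  "partition_fps h = (\<Prod>n. inverse (1 - fps_X ^ nat \<lfloor>h (real (Suc n))\<rfloor>))"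

definition p_h :: "(real \<Rightarrow> real) \<Rightarrow> nat \<Rightarrow> real" where
  "p_h h n = fps_nth (partition_fps h) n"

definition w' :: "(real \<Rightarrow> real) \<Rightarrow> nat \<Rightarrow> complex \<Rightarrow> complex" where
  "w' h k s = (LINT x:{0..}|lborel. exp (- s * of_nat k * of_real (h x)))"

definition lam :: "(real \<Rightarrow> real) \<Rightarrow> nat \<Rightarrow> complex \<Rightarrow> complex" where
  "lam h N s = (\<Sum>k=1..N. w' h k s / of_nat k)"

definition vertical_integral ::
    "(real \<Rightarrow> real) \<Rightarrow> nat \<Rightarrow> real \<Rightarrow> real \<Rightarrow> real \<Rightarrow> complex" where
  "vertical_integral h N c x T =
     contour_integral (linepath (Complex c (- T)) (Complex c T))
       (\<lambda>s. 1 / s * exp (lam h N s) * exp (of_real x * s))"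

definition phi_h :: "(real \<Rightarrow> real) \<Rightarrow> nat \<Rightarrow> real \<Rightarrow> real \<Rightarrow> complex" where
  "phi_h h N c x =
     1 / (2 * of_real pi * \<i>) * Lim at_top (\<lambda>T. vertical_integral h N c x T)"

text \<open>The infinite product defining \<open>partition_fps\<close> converges, so it is not a default value.\<close>

lemma has_prod_partition_fps:
  assumes mono: "strict_mono_on {0..} h" and h0: "h 0 = 0"
    and int: "\<And>n::nat. h (real n) \<in> \<int>"
  shows "(\<lambda>n. inverse (1 - fps_X ^ nat \<lfloor>h (real (Suc n))\<rfloor>)) has_prod partition_fps h"
proof -
  define a where "a n = nat \<lfloor>h (real n)\<rfloor>" for n
  have step: "a n < a (Suc n)" for n
  proof -
    have "h (real n) < h (real (Suc n))"
      using mono by (auto simp: strict_mono_on_def)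
    then have "\<lfloor>h (real n)\<rfloor> < \<lfloor>h (real (Suc n))\<rfloor>"
      using int[of n] int[of "Suc n"] by (auto elim!: Ints_cases)
    moreover have "h (real n) \<ge> 0"
      using strict_mono_onD[OF mono, of 0 "real n"] h0 by (cases "n = 0") auto
    ultimately show ?thesis
      unfolding a_def by (subst nat_less_eq_zless) simp_all
  qed
  have ge: "a n \<ge> n" for n
  proof (induction n)
    case (Suc n)
    then show ?case
      using step[of n] by linarith
  qed simp
  define F :: "nat \<Rightarrow> real fps" where "F n = inverse (1 - fps_X ^ a (Suc n))" for n
  define P where "P m = (\<Prod>i\<le>m. F i)" for m
  have P_Suc: "P (Suc m) = P m + fps_X ^ a (Suc (Suc m)) * P (Suc m)" for m
  proof -
    have "a (Suc (Suc m)) > 0"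
      using ge[of "Suc (Suc m)"] by linarith
    then have "F (Suc m) * (1 - fps_X ^ a (Suc (Suc m))) = 1"
      unfolding F_def by (intro inverse_mult_eq_1) simp
    moreover have "P (Suc m) = P m * F (Suc m)"
      by (simp add: P_def)
    ultimately have *: "P (Suc m) * (1 - fps_X ^ a (Suc (Suc m))) = P m"
      by (simp only: mult.assoc mult_1_right)
    show ?thesis
      by (subst *[symmetric]) (simp only: right_diff_distrib mult_1_right mult.commute[of _ "P (Suc m)"] diff_add_cancel)
  qed
  have stab: "fps_nth (P (Suc m)) n = fps_nth (P m) n" if "n \<le> m" for m n
  proof -
    have "n < a (Suc (Suc m))"
      using ge[of "Suc (Suc m)"] that by linarith
    then show ?thesis
      using arg_cong[OF P_Suc[of m], of "\<lambda>f. fps_nth f n"]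
      by (simp only: fps_add_nth fps_X_power_mult_nth if_True add_0_right)
  qed
  have stab': "fps_nth (P m) n = fps_nth (P n) n" if "n \<le> m" for m n
    using that
  proof (induction m rule: dec_induct)
    case (step k)
    then show ?case
      using stab[of n k] by linarith
  qed simp
  define L where "L = Abs_fps (\<lambda>n. fps_nth (P n) n)"
  have lim: "P \<longlonglongrightarrow> L"
  proof (rule tendsto_fpsI)
    fix n
    show "eventually (\<lambda>m. fps_nth (P m) n = fps_nth L n) sequentially"
      using eventually_ge_at_top[of n]
    proof eventually_elim
      case (elim m)
      then show ?case
        using stab'[of n m] by (simp only: L_def fps_nth_Abs_fps)
    qed
  qed
  have "a 1 > 0"
    using ge[of 1] by linarith
  then have "fps_nth L 0 = 1"
    by (simp add: L_def P_def F_def)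
  then have "L \<noteq> 0"
    by auto
  with lim have "F has_prod L"
    unfolding has_prod_def raw_has_prod_def P_def[abs_def] by simp
  moreover have eq: "partition_fps h = prodinf F"
    unfolding partition_fps_def F_def[abs_def] a_def ..
  ultimately have "F has_prod partition_fps h"
    using has_prod_unique[of F L] by metis
  then show ?thesis
    unfolding F_def[abs_def] a_def .
qed

end

theory Submission
  imports Defs "HOL-Probability.Sinc_Integral"
begin

text \<open>
  Let \<open>A\<close> be the operator \<open>(A f)(y) = (\<Sum>k=1..N. 1/k \<integral>\<^sub>0\<^sup>\<infinity> f (y - k h(x)) dx)\<close>. The exponential \<open>y \<mapsto> exp (s y)\<close>
  is an eigenfunction of \<open>A\<close> with eigenvalue \<open>\<lambda>(s)\<close>, so the truncated vertical integral of
  \<open>exp (\<lambda>(s)) exp (x s) / s\<close> is \<open>exp A\<close> applied to the truncated Perron kernel. That kernel is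
  \<open>O(exp (c y))\<close> uniformly in \<open>T\<close> and converges, off the origin, to the Heaviside function \<open>H\<close>.
  As \<open>h\<close> is injective, the shifts \<open>k h(x)\<close> have no atoms, and dominated convergence gives
  \<open>\<phi>(x) = (\<Sum>m. (A\<^sup>m H)(x) / m!)\<close>.

  On the other side, let \<open>L = (\<Sum>k\<le>N. \<Sum>n\<ge>1. X\<^bsup>k h(n)\<^esup> / k)\<close>. Then \<open>exp L\<close> agrees with the generating function
  of \<open>p\<^sub>h\<close> up to order \<open>N\<close>, so that the sum of the \<open>p\<^sub>h(n)\<close> is the \<open>N\<close>-th coefficient of \<open>exp L / (1 - X)\<close>.
  All \<open>A\<^sup>m H\<close> are monotone; comparing the integral over \<open>x\<close> with its lower and upper sums over unit
  intervals traps \<open>(A\<^sup>m H)(N)\<close> between the \<open>N\<close>-th coefficients of \<open>L\<^sup>m / (1 - X)\<close> and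
  \<open>(L + \<eta>)\<^sup>m / (1 - X)\<close>, where \<open>\<eta> = 1 + 1/2 + \<dots> + 1/N\<close> comes from \<open>n = 0\<close>. Finally \<open>exp \<eta> \<le> e N\<close>.
\<close>

section \<open>The truncated Perron kernel\<close>

lemma exp_decay_integrable:
  fixes c :: real
  assumes "c > 0"
  shows "set_integrable lborel {0..} (\<lambda>v. exp (- c * v))"
    and "set_integrable lborel {0..} (\<lambda>v. v * exp (- c * v))"
proof -
  have "integrable lborel (\<lambda>x. x ^ k * exp (- x) * indicator {0..} x :: real)" for k
    using has_bochner_integral_I0i_power_exp_m'[of k] by (rule integrable.intros)
  then have I: "integrable lborel (\<lambda>x. (0 + c * x) ^ k * exp (- (0 + c * x)) * indicator {0..} (0 + c * x) :: real)" for k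
    by (subst lborel_integrable_real_affine_iff) (use assms in auto)
  have ind: "indicator {0..} (0 + c * x) = (indicator {0..} x :: real)" for x
    using assms by (auto simp: indicator_def zero_le_mult_iff)
  show "set_integrable lborel {0..} (\<lambda>v. exp (- c * v))"
    using I[of 0] unfolding set_integrable_def ind by (simp add: mult.commute)
  have "integrable lborel (\<lambda>x. (1 / c) * ((0 + c * x) ^ 1 * exp (- (0 + c * x)) * indicator {0..} (0 + c * x)) :: real)"
    by (intro integrable_mult_right I)
  then show "set_integrable lborel {0..} (\<lambda>v. v * exp (- c * v))"
    unfolding set_integrable_def ind using assms by (simp add: mult_ac)
qed

lemma set_integral_exp_decay_complex:
  fixes s :: complex
  assumes "Re s > 0"
  shows "(LINT v:{0..}|lborel. exp (- s * of_real v)) = 1 / s"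
proof -
  have s0: "s \<noteq> 0" using assms by auto
  have "set_integrable lborel {0..} (\<lambda>v. exp (- s * of_real v))"
    using exp_decay_integrable(1)[OF assms]
    unfolding set_integrable_def
    by (rule Bochner_Integration.integrable_bound) (auto simp: norm_exp_eq_Re)
  then have si: "set_integrable lborel (einterval 0 \<infinity>) (\<lambda>v. exp (- s * of_real v))"
    by (rule set_integrable_subset) (auto simp: einterval_def)
  have "(LBINT v=0..\<infinity>. exp (- s * of_real v)) = 0 - (- (1 / s))"
  proof (rule interval_integral_FTC_integrable[where F="\<lambda>v. - exp (- s * of_real v) / s"])
    fix x :: real
    show "((\<lambda>v. - exp (- s * of_real v) / s) has_vector_derivative exp (- s * of_real x)) (at x)"
      using s0 by (auto intro!: derivative_eq_intros has_vector_derivative_real_field)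
    show "isCont (\<lambda>v. exp (- s * complex_of_real v)) x"
      by (intro continuous_intros)
  next
    have "isCont (\<lambda>v. - exp (- s * complex_of_real v) / s) 0"
      using s0 by (intro continuous_intros) auto
    then have "((\<lambda>v. - exp (- s * complex_of_real v) / s) \<longlongrightarrow> - (1 / s)) (at_right 0)"
      by (auto simp: isCont_def dest: tendsto_within_subset[where T="{0<..}"])
    then show "(((\<lambda>v. - exp (- s * complex_of_real v) / s) \<circ> real_of_ereal) \<longlongrightarrow> - (1 / s)) (at_right 0)"
      unfolding zero_ereal_def by (simp add: ereal_tendsto_simps1)
  next
    have "((\<lambda>v::real. exp (- (Re s) * v) / norm s) \<longlongrightarrow> 0) at_top"
    proof -
      have "filterlim (\<lambda>v. - (Re s) * v) at_bot at_top"
        using assms by (intro filterlim_tendsto_neg_mult_at_bot[OF tendsto_const] filterlim_ident) auto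
      then have "((\<lambda>v. exp (- (Re s) * v)) \<longlongrightarrow> 0) at_top"
        by (rule filterlim_compose[OF exp_at_bot])
      then show ?thesis by (rule tendsto_divide_zero)
    qed
    then have "((\<lambda>v. - exp (- s * complex_of_real v) / s) \<longlongrightarrow> 0) at_top"
      by (intro tendsto_norm_zero_cancel[where f="\<lambda>v. - exp (- s * complex_of_real v) / s"])
         (simp add: norm_divide norm_exp_eq_Re)
    then show "(((\<lambda>v. - exp (- s * complex_of_real v) / s) \<circ> real_of_ereal) \<longlongrightarrow> 0) (at_left \<infinity>)"
      by (simp add: ereal_tendsto_simps1)
  qed (use si in auto)
  moreover have "(LBINT v=0..\<infinity>. exp (- s * of_real v)) = (LINT v:{0<..}|lborel. exp (- s * of_real v))"
    by (simp add: interval_lebesgue_integral_0_infty)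
  moreover have "\<dots> = (LINT v:{0..}|lborel. exp (- s * of_real v))"
    unfolding set_lebesgue_integral_def
    using AE_lborel_singleton[of "0::real"] by (intro integral_cong_AE) (auto simp: indicator_def)
  ultimately show ?thesis by simp
qed

lemma set_integral_exp_decay:
  fixes c :: real
  assumes "c > 0"
  shows "(LINT v:{0..}|lborel. exp (- c * v)) = 1 / c"
proof -
  have "complex_of_real (LINT v:{0..}|lborel. exp (- c * v)) = (LINT v:{0..}|lborel. exp (- of_real c * of_real v))"
    unfolding set_lebesgue_integral_def
    by (subst integral_complex_of_real[symmetric]) (simp add: exp_of_real[symmetric] scaleR_conv_of_real)
  also have "\<dots> = of_real (1 / c)"
    using set_integral_exp_decay_complex[of "of_real c"] assms by simp
  finally show ?thesis using of_real_eq_iff by blast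
qed

text \<open>A product of integrable functions is integrable on the product space by Tonelli, so
  domination by it justifies Fubini. Both exchanges of integrals below rest on this: the one with
  the sine kernel and the one with the shift operator.\<close>

lemma (in pair_sigma_finite) integrable_pair_bound_product:
  fixes f :: "'a \<times> 'b \<Rightarrow> 'c :: {banach, second_countable_topology}"
    and u :: "'a \<Rightarrow> real" and w :: "'b \<Rightarrow> real"
  assumes f: "f \<in> borel_measurable (M1 \<Otimes>\<^sub>M M2)"
    and u: "integrable M1 u" and w: "integrable M2 w"
    and bound: "\<And>x y. x \<in> space M1 \<Longrightarrow> y \<in> space M2 \<Longrightarrow> norm (f (x, y)) \<le> u x * w y"
  shows "integrable (M1 \<Otimes>\<^sub>M M2) f"
proof (rule Bochner_Integration.integrable_bound)
  have [measurable]: "u \<in> borel_measurable M1" "w \<in> borel_measurable M2"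
    using u w by auto
  show "integrable (M1 \<Otimes>\<^sub>M M2) (\<lambda>(x, y). u x * w y)"
  proof (rule Fubini_integrable)
    show "integrable M1 (\<lambda>x. \<integral>y. norm (case (x, y) of (x, y) \<Rightarrow> u x * w y) \<partial>M2)"
      using u by (simp add: abs_mult)
  qed (use w in auto)
  show "AE x in M1 \<Otimes>\<^sub>M M2. norm (f x) \<le> norm (case x of (x, y) \<Rightarrow> u x * w y)"
  proof (rule AE_I2)
    fix x assume "x \<in> space (M1 \<Otimes>\<^sub>M M2)"
    then obtain a b where "x = (a, b)" "a \<in> space M1" "b \<in> space M2"
      by (auto simp: space_pair_measure)
    then show "norm (f x) \<le> norm (case x of (x, y) \<Rightarrow> u x * w y)"
      using bound[of a b] by simp
  qed
qed (rule f)

lemma abs_sin_scale_divide_le: "\<bar>sin (t * \<theta>) / t\<bar> \<le> \<bar>\<theta>\<bar>" for t \<theta> :: real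
  using abs_sin_x_le_abs_x[of "t * \<theta>"] by (cases "t = 0") (auto simp: abs_mult field_simps)

lemma set_integral_sin_scale_divide:
  assumes "T \<ge> 0"
  shows "(LINT t:{-T..T}|lborel. sin (t * \<theta>) / t) = Si (T * \<theta>) - Si (- T * \<theta>)"
proof -
  have "(LINT t:{-T..T}|lborel. sin (t * \<theta>) / t) = (\<integral>t. \<theta> * sinc (t * \<theta>) * indicator {-T..T} t \<partial>lborel)"
    unfolding set_lebesgue_integral_def
  proof (rule integral_cong_AE)
    \<comment> \<open>At t = 0 the quotient is 0 by the convention for division, while
      \<open>sinc\<close> is 1 there, so the integrands agree only almost everywhere.\<close>
    show "AE t in lborel. indicator {-T..T} t *\<^sub>R (sin (t * \<theta>) / t) = \<theta> * sinc (t * \<theta>) * indicator {-T..T} t"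
      using AE_lborel_singleton[of "0::real"] by eventually_elim auto
  qed measurable
  also have "\<dots> = Si (T * \<theta>) - Si (- T * \<theta>)"
  proof (rule integral_FTC_Icc_real)
    fix t
    have "((\<lambda>t. Si (t * \<theta>)) has_real_derivative sinc (t * \<theta>) * \<theta>) (at t)"
      by (rule DERIV_chain2[OF DERIV_Si]) (auto intro!: derivative_eq_intros)
    then show "((\<lambda>t. Si (t * \<theta>)) has_real_derivative \<theta> * sinc (t * \<theta>)) (at t)"
      by (simp only: mult.commute)
    have "isCont (\<lambda>t. sinc (t * \<theta>)) t"
      by (rule continuous_within_compose3[OF isCont_sinc]) (intro continuous_intros)
    then show "isCont (\<lambda>t. \<theta> * sinc (t * \<theta>)) t"
      by (intro continuous_intros)
  qed (use assms in auto)
  finally show ?thesis .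
qed

text \<open>The integrand is the imaginary part of exp(i t y) exp(-(c + i t) v), so the integral is
  read off from the complex Laplace integral at s = c + i t.\<close>

lemma set_integral_exp_decay_sin:
  fixes c t y :: real
  assumes "c > 0"
  shows "(LINT v:{0..}|lborel. exp (- c * v) * sin (t * (y - v))) = Im (exp (\<i> * of_real (t * y)) / Complex c t)"
proof -
  let ?f = "\<lambda>v. exp (\<i> * of_real (t * y)) * exp (- Complex c t * of_real v)"
  have int: "set_integrable lborel {0..} (\<lambda>v. exp (- Complex c t * of_real v))"
    using exp_decay_integrable(1)[OF assms] unfolding set_integrable_def
    by (rule Bochner_Integration.integrable_bound) (auto simp: norm_exp_eq_Re)
  have "(LINT v:{0..}|lborel. exp (- c * v) * sin (t * (y - v))) = (LINT v:{0..}|lborel. Im (?f v))"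
  proof -
    have "?f v = exp (Complex (- c * v) (t * (y - v)))" for v
      by (subst exp_add[symmetric], rule arg_cong[where f=exp]) (simp add: complex_eq_iff algebra_simps)
    then show ?thesis by (simp add: Im_exp)
  qed
  also have "\<dots> = Im (LINT v:{0..}|lborel. ?f v)"
    unfolding set_lebesgue_integral_def
    by (subst integral_Im[symmetric])
       (use set_integrable_mult_right[OF int, of "exp (\<i> * of_real (t * y))"] in \<open>auto simp: set_integrable_def\<close>)
  also have "(LINT v:{0..}|lborel. ?f v) = exp (\<i> * of_real (t * y)) / Complex c t"
    using set_integral_exp_decay_complex[of "Complex c t"] assms by simp
  finally show ?thesis .
qed

text \<open>With s = c + i t this is the integral of exp(y s) / s over the segment from c - i T to c
  + i T, divided by i. The factor 1 / (2 pi) is left out, so the limit is 2 pi times the Heaviside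
  function.\<close>

definition perron_kernel :: "real \<Rightarrow> real \<Rightarrow> real \<Rightarrow> complex" where
  "perron_kernel c T y =
     (LINT t:{-T..T}|lborel. exp (of_real y * Complex c t) / Complex c t)"

text \<open>The substitution t -> -t turns the integrand into its conjugate. Hence the kernel is
  real and only its real part has to be computed.\<close>

lemma perron_kernel_cnj: "cnj (perron_kernel c T y) = perron_kernel c T y"
proof -
  have "cnj (perron_kernel c T y) =
    (\<integral>t. cnj (indicator {-T..T} t *\<^sub>R (exp (of_real y * Complex c t) / Complex c t)) \<partial>lborel)"
    unfolding perron_kernel_def set_lebesgue_integral_def by (rule Bochner_Integration.integral_cnj[symmetric])
  also have "\<dots> = (\<integral>t. indicator {-T..T} (0 + (-1) * t) *\<^sub>R (exp (of_real y * Complex c (0 + (-1) * t)) / Complex c (0 + (-1) * t)) \<partial>lborel)"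
    by (intro Bochner_Integration.integral_cong)
       (auto simp: indicator_def exp_cnj complex_cnj)
  also have "\<dots> = perron_kernel c T y"
    unfolding perron_kernel_def set_lebesgue_integral_def
    by (subst (2) lborel_integral_real_affine[of "-1" _ 0]) auto
  finally show ?thesis .
qed

lemma perron_kernel_measurable_integrand [measurable]:
  "(\<lambda>t. exp (of_real y * Complex c t) / Complex c t) \<in> borel_measurable borel"
  unfolding Complex_eq by measurable

lemma perron_kernel_integrable:
  assumes "c > 0"
  shows "set_integrable lborel {-T..T} (\<lambda>t. exp (of_real y * Complex c t) / Complex c t)"
  unfolding set_integrable_def
proof (rule Bochner_Integration.integrable_bound)
  show "integrable lborel (\<lambda>t. indicator {-T..T} t *\<^sub>R (exp (c * y) / c))"
    by (rule integrable_scaleR_left) (simp add: integrable_indicator_iff emeasure_lborel_Icc_eq)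
  have "norm (exp (of_real y * Complex c t) / Complex c t) \<le> exp (c * y) / c" for t
    using complex_Re_le_cmod[of "Complex c t"] assms
    by (auto simp: norm_divide norm_exp_eq_Re mult.commute intro!: divide_left_mono mult_pos_pos)
  then show "AE t in lborel. norm (indicator {-T..T} t *\<^sub>R (exp (of_real y * Complex c t) / Complex c t))
        \<le> norm (indicator {-T..T} t *\<^sub>R (exp (c * y) / c))"
    using assms by (intro AE_I2) (auto simp: indicator_def)
qed measurable

text \<open>
  Integrating \<open>sin (t z) / t\<close> against \<open>\<delta>\<^sub>0\<close> minus the exponential distribution with rate \<open>c\<close>,
  where \<open>z = y - v\<close>, produces exactly the real part of \<open>exp (\<i> t y) / (c + \<i> t)\<close>.
\<close>

lemma perron_kernel_eq_Si:
  fixes c T y :: real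
  assumes c: "c > 0" and T: "T \<ge> 0"
  defines "D \<equiv> \<lambda>z. Si (T * z) - Si (- T * z)"
  shows "perron_kernel c T y =
    of_real (exp (c * y) * (D y - c * (LINT v:{0..}|lborel. exp (- c * v) * D (y - v))))"
proof -
  let ?F = "\<lambda>t. exp (of_real y * Complex c t) / Complex c t"
  let ?q = "\<lambda>v t. exp (- c * v) * (sin (t * (y - v)) / t)"
  let ?f = "\<lambda>(v, t). indicator {0..} v * (indicator {-T..T} t * ?q v t) :: real"
  \<comment> \<open>Since |sin(t z) / t| \<le> |z| \<le> |y| + v for z = y - v, the integrand is
    bounded by a function of v times the indicator of the interval; the summand v is why v exp(-c v)
    must be integrable too.\<close>
  have pair: "integrable (lborel \<Otimes>\<^sub>M lborel) ?f"
  proof (rule lborel_pair.integrable_pair_bound_product)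
    show "integrable lborel (\<lambda>v. indicator {0..} v * (exp (- c * v) * \<bar>y\<bar> + v * exp (- c * v)))"
      using exp_decay_integrable[OF c] unfolding set_integrable_def
      by (simp only: real_scaleR_def distrib_left mult.assoc[symmetric])
         (intro Bochner_Integration.integrable_add integrable_mult_left)
    show "integrable lborel (\<lambda>t. indicator {-T..T} t :: real)"
      by (simp add: integrable_indicator_iff emeasure_lborel_Icc_eq)
    fix v t :: real
    have "\<bar>?q v t\<bar> \<le> exp (- c * v) * (\<bar>y\<bar> + v)" if "v \<ge> 0"
      unfolding abs_mult using abs_sin_scale_divide_le[of t "y - v"] that
      by (intro mult_mono) auto
    then show "norm (?f (v, t)) \<le> indicator {0..} v * (exp (- c * v) * \<bar>y\<bar> + v * exp (- c * v)) * indicator {-T..T} t"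
      by (auto simp: indicator_def algebra_simps)
  qed measurable
  have "(\<integral>t. (\<integral>v. ?f (v, t) \<partial>lborel) \<partial>lborel) = (\<integral>v. (\<integral>t. ?f (v, t) \<partial>lborel) \<partial>lborel)"
    using lborel_pair.Fubini_integral[of "\<lambda>v t. ?f (v, t)"] pair by simp
  also have "(\<lambda>v. \<integral>t. ?f (v, t) \<partial>lborel) = (\<lambda>v. indicator {0..} v * (exp (- c * v) * D (y - v)))"
  proof
    fix v
    have "(\<integral>t. ?f (v, t) \<partial>lborel) = indicator {0..} v * (exp (- c * v) * (LINT t:{-T..T}|lborel. sin (t * (y - v)) / t))"
      unfolding set_lebesgue_integral_def integral_mult_right_zero[symmetric]
      by (intro Bochner_Integration.integral_cong) auto
    then show "(\<integral>t. ?f (v, t) \<partial>lborel) = indicator {0..} v * (exp (- c * v) * D (y - v))"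
      unfolding set_integral_sin_scale_divide[OF T] D_def by simp
  qed
  finally have swap: "(\<integral>t. (\<integral>v. ?f (v, t) \<partial>lborel) \<partial>lborel) = (LINT v:{0..}|lborel. exp (- c * v) * D (y - v))"
    by (simp add: set_lebesgue_integral_def)
  have inner: "(\<integral>v. ?f (v, t) \<partial>lborel) = indicator {-T..T} t * ((1 / t) * Im (exp (\<i> * of_real (t * y)) / Complex c t))" for t
    unfolding set_integral_exp_decay_sin[OF c, symmetric] set_lebesgue_integral_def integral_mult_right_zero[symmetric]
    by (intro Bochner_Integration.integral_cong) auto
  have int1: "integrable lborel (\<lambda>t. indicator {-T..T} t * (sin (t * y) / t))"
  proof (rule Bochner_Integration.integrable_bound)
    show "integrable lborel (\<lambda>t. indicator {-T..T} t * \<bar>y\<bar>)"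
      by (intro integrable_mult_left) (simp add: integrable_indicator_iff emeasure_lborel_Icc_eq)
    show "AE t in lborel. norm (indicator {-T..T} t * (sin (t * y) / t)) \<le> norm (indicator {-T..T} t * \<bar>y\<bar>)"
      using abs_sin_scale_divide_le[of _ y] by (intro AE_I2) (auto simp: indicator_def)
  qed measurable
  have int2: "integrable lborel (\<lambda>t. \<integral>v. ?f (v, t) \<partial>lborel)"
    using lborel_pair.integrable_snd[of "\<lambda>v t. ?f (v, t)"] pair by simp
  have Re: "Re (?F t) = exp (c * y) * (sin (t * y) / t - c * ((1 / t) * Im (exp (\<i> * of_real (t * y)) / Complex c t)))"
    if "t \<noteq> 0" for t
  proof -
    let ?z = "exp (\<i> * of_real (t * y))"
    have nz: "Complex c t \<noteq> 0" using c by (auto simp: complex_eq_iff)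
    have "exp (of_real y * Complex c t) = of_real (exp (c * y)) * ?z"
      by (simp add: exp_of_real[symmetric] exp_add[symmetric] Complex_eq algebra_simps)
    then have 1: "Re (?F t) = exp (c * y) * Re (?z / Complex c t)"
      by (simp add: times_divide_eq_right[symmetric] del: times_divide_eq_right)
    define w where "w = ?z / Complex c t"
    \<comment> \<open>This is (c + i t) w = z rearranged. Its imaginary part expresses t Re w
      through Im z and Im w, which is the decomposition into sine integrals.\<close>
    have "?z - of_real c * w = \<i> * of_real t * w"
      using nz by (simp add: w_def field_simps Complex_eq)
    then have "Im (?z - of_real c * w) = Im (\<i> * of_real t * w)" by simp
    then have "Im ?z - c * Im (?z / Complex c t) = t * Re (?z / Complex c t)"
      unfolding w_def[symmetric] minus_complex.simps by simp
    moreover have "Im ?z = sin (t * y)" by (simp add: Im_exp)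
    ultimately have "sin (t * y) - c * Im (?z / Complex c t) = t * Re (?z / Complex c t)" by simp
    then have "Re (?z / Complex c t) = sin (t * y) / t - c * ((1 / t) * Im (?z / Complex c t))"
      using that by (simp add: field_simps)
    then show ?thesis using 1 by simp
  qed
  have "Re (perron_kernel c T y) = (\<integral>t. Re (indicator {-T..T} t *\<^sub>R ?F t) \<partial>lborel)"
    unfolding perron_kernel_def set_lebesgue_integral_def
    using perron_kernel_integrable[OF c] by (intro integral_Re[symmetric]) (simp add: set_integrable_def)
  also have "\<dots> = (\<integral>t. exp (c * y) * (indicator {-T..T} t * (sin (t * y) / t) - c * (\<integral>v. ?f (v, t) \<partial>lborel)) \<partial>lborel)"
  proof (rule integral_cong_AE)
    show "AE t in lborel. Re (indicator {-T..T} t *\<^sub>R ?F t) =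
       exp (c * y) * (indicator {-T..T} t * (sin (t * y) / t) - c * (\<integral>v. ?f (v, t) \<partial>lborel))"
      using AE_lborel_singleton[of "0::real"] unfolding inner
    proof eventually_elim
      case (elim t)
      then show ?case using Re[of t] by (cases "t \<in> {-T..T}") auto
    qed
  next
    show "(\<lambda>t. Re (indicator {-T..T} t *\<^sub>R ?F t)) \<in> borel_measurable lborel" by measurable
  next
    show "(\<lambda>t. exp (c * y) * (indicator {-T..T} t * (sin (t * y) / t) - c * (\<integral>v. ?f (v, t) \<partial>lborel))) \<in> borel_measurable lborel"
      using borel_measurable_integrable[OF int1] borel_measurable_integrable[OF int2]
      by (intro borel_measurable_times[OF borel_measurable_const] borel_measurable_diff)
  qed
  also have "\<dots> = exp (c * y) * (D y - c * (LINT v:{0..}|lborel. exp (- c * v) * D (y - v)))"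
  proof -
    have "(\<integral>t. indicator {-T..T} t * (sin (t * y) / t) - c * (\<integral>v. ?f (v, t) \<partial>lborel) \<partial>lborel) =
        (\<integral>t. indicator {-T..T} t * (sin (t * y) / t) \<partial>lborel) - c * (\<integral>t. (\<integral>v. ?f (v, t) \<partial>lborel) \<partial>lborel)"
      by (simp only: Bochner_Integration.integral_diff[OF int1 integrable_mult_right[OF int2]] integral_mult_right_zero)
    moreover have "(\<integral>t. indicator {-T..T} t * (sin (t * y) / t) \<partial>lborel) = D y"
      using set_integral_sin_scale_divide[OF T, of y] by (simp add: D_def set_lebesgue_integral_def)
    ultimately show ?thesis unfolding integral_mult_right_zero swap by simp
  qed
  finally show ?thesis
    using perron_kernel_cnj[of c T y] by (auto simp: complex_eq_iff)
qed

text \<open>Bounding the integrand by its absolute value would cost a factor log T. The formula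
  through \<open>Si\<close> avoids this: \<open>Si\<close> is bounded, and c exp(-c v) is a
  probability density on the half-line, so the two terms of the formula are each at most twice the
  bound of \<open>Si\<close>.\<close>

lemma perron_kernel_bounded:
  fixes c :: real
  assumes c: "c > 0"
  obtains B where "\<And>T y. T \<ge> 0 \<Longrightarrow> norm (perron_kernel c T y) \<le> B * exp (c * y)"
proof -
  obtain B0 where B0: "\<And>z. \<bar>Si z\<bar> \<le> B0" using bounded_Si by blast
  show thesis
  proof
    fix T y :: real assume T: "T \<ge> 0"
    define D where "D = (\<lambda>z. Si (T * z) - Si (- T * z))"
    have D: "\<bar>D z\<bar> \<le> 2 * B0" for z
      unfolding D_def using B0[of "T * z"] B0[of "- T * z"] by linarith
    have "\<bar>LINT v:{0..}|lborel. exp (- c * v) * D (y - v)\<bar> \<le> (LINT v:{0..}|lborel. exp (- c * v) * (2 * B0))"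
      unfolding set_lebesgue_integral_def real_norm_def[symmetric]
    proof (rule Bochner_Integration.integral_norm_bound_integral)
      have I: "integrable lborel (\<lambda>v. indicator {0..} v *\<^sub>R (exp (- c * v) * (2 * B0)))"
        using set_integrable_mult_left[OF exp_decay_integrable(1)[OF c], of "2 * B0"]
        by (simp add: set_integrable_def)
      have b: "norm (indicator {0..} v *\<^sub>R (exp (- c * v) * D (y - v))) \<le> indicator {0..} v *\<^sub>R (exp (- c * v) * (2 * B0))" for v
        using D[of "y - v"] by (auto simp: indicator_def abs_mult)
      have [measurable]: "D \<in> borel_measurable borel" unfolding D_def by measurable
      show "integrable lborel (\<lambda>v. indicator {0..} v *\<^sub>R (exp (- c * v) * D (y - v)))"
        by (rule Bochner_Integration.integrable_bound[OF I])
           (measurable, intro AE_I2, use order.trans[OF b abs_ge_self] in simp)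
      show "integrable lborel (\<lambda>v. indicator {0..} v *\<^sub>R (exp (- c * v) * (2 * B0)))" by (rule I)
      show "norm (indicator {0..} v *\<^sub>R (exp (- c * v) * D (y - v))) \<le> indicator {0..} v *\<^sub>R (exp (- c * v) * (2 * B0))" for v
        by (rule b)
    qed
    also have "\<dots> = 2 * B0 / c"
      using set_integral_exp_decay[OF c] by simp
    finally have "\<bar>c * (LINT v:{0..}|lborel. exp (- c * v) * D (y - v))\<bar> \<le> 2 * B0"
      using c by (simp add: abs_mult field_simps)
    then have "\<bar>D y - c * (LINT v:{0..}|lborel. exp (- c * v) * D (y - v))\<bar> \<le> 4 * B0"
      using D[of y] by linarith
    moreover have "perron_kernel c T y = of_real (exp (c * y) * (D y - c * (LINT v:{0..}|lborel. exp (- c * v) * D (y - v))))"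
      unfolding D_def by (rule perron_kernel_eq_Si[OF c T])
    ultimately show "norm (perron_kernel c T y) \<le> (4 * B0) * exp (c * y)"
      by (simp only: norm_of_real abs_mult) (simp add: mult.commute)
  qed
qed

lemma tendsto_Si_diff_scaled:
  assumes "y \<noteq> 0"
  shows "((\<lambda>T. Si (T * y) - Si (- T * y)) \<longlongrightarrow> pi * sgn y) at_top"
proof -
  have "((\<lambda>z. Si z - Si (- z)) \<longlongrightarrow> pi / 2 - (- (pi / 2))) at_top"
  proof (rule tendsto_diff[OF Si_at_top])
    have "((\<lambda>z. - Si z) \<longlongrightarrow> - (pi / 2)) at_top"
      by (intro tendsto_minus Si_at_top)
    then show "((\<lambda>z. Si (- z)) \<longlongrightarrow> - (pi / 2)) at_top"
      by (rule Lim_transform_eventually)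
         (use eventually_ge_at_top[of 0] in \<open>eventually_elim, simp add: Si_neg\<close>)
  qed
  then have *: "((\<lambda>z. Si z - Si (- z)) \<longlongrightarrow> pi) at_top" by simp
  have lin: "filterlim (\<lambda>T. T * \<bar>y\<bar>) at_top at_top"
    using assms by (intro filterlim_at_top_mult_tendsto_pos[OF tendsto_const] filterlim_ident) auto
  have "((\<lambda>T. sgn y * (Si (T * \<bar>y\<bar>) - Si (- (T * \<bar>y\<bar>)))) \<longlongrightarrow> sgn y * pi) at_top"
    by (intro tendsto_intros filterlim_compose[OF * lin])
  moreover have "sgn y * (Si (T * \<bar>y\<bar>) - Si (- (T * \<bar>y\<bar>))) = Si (T * y) - Si (- T * y)" for T
    using assms by (cases "y > 0") auto
  ultimately show ?thesis by (simp add: mult.commute)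
qed

text \<open>For almost every v \<ge> 0 the sign of y - v is 2 * [v \<le> y] - 1, and the interval
  from 0 to y is a null set unless y > 0.\<close>

lemma set_integral_exp_decay_sgn:
  fixes c y :: real
  assumes c: "c > 0"
  shows "c * (LINT v:{0..}|lborel. exp (- c * v) * sgn (y - v)) = (if y > 0 then 1 - 2 * exp (- c * y) else -1)"
proof -
  have i: "integrable lborel (\<lambda>v. indicator {0..} v * exp (- c * v))"
    using exp_decay_integrable(1)[OF c] by (simp add: set_integrable_def)
  have j: "integrable lborel (\<lambda>v. indicator {0..y} v * exp (- c * v))"
    using set_integrable_subset[OF exp_decay_integrable(1)[OF c], of "{0..y}"] by (simp add: set_integrable_def)
  have "(LINT v:{0..}|lborel. exp (- c * v) * sgn (y - v)) =
     (\<integral>v. 2 * (indicator {0..y} v * exp (- c * v)) - indicator {0..} v * exp (- c * v) \<partial>lborel)"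
    unfolding set_lebesgue_integral_def
  proof (rule integral_cong_AE)
    show "AE v in lborel. indicator {0..} v *\<^sub>R (exp (- c * v) * sgn (y - v)) =
       2 * (indicator {0..y} v * exp (- c * v)) - indicator {0..} v * exp (- c * v)"
      using AE_lborel_singleton[of y] by eventually_elim (auto simp: indicator_def sgn_if)
  qed measurable
  also have "\<dots> = 2 * (\<integral>v. indicator {0..y} v * exp (- c * v) \<partial>lborel) - 1 / c"
    using i j set_integral_exp_decay[OF c] by (simp add: set_lebesgue_integral_def)
  also have "(\<integral>v. indicator {0..y} v * exp (- c * v) \<partial>lborel) = (if y > 0 then (1 - exp (- c * y)) / c else 0)"
  proof (cases "y > 0")
    case True
    have "(\<integral>v. exp (- c * v) * indicator {0..y} v \<partial>lborel) = - exp (- c * y) / c - (- exp (- c * 0) / c)"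
      by (rule integral_FTC_Icc_real)
         (use c True in \<open>auto intro!: derivative_eq_intros continuous_intros\<close>)
    then show ?thesis using True by (simp add: mult.commute diff_divide_distrib)
  next
    case False
    have "(\<integral>v. indicator {0..y} v * exp (- c * v) \<partial>lborel) = (\<integral>v. 0 \<partial>(lborel :: real measure))"
    proof (rule integral_cong_AE)
      show "AE v in lborel. indicator {0..y} v * exp (- c * v) = 0"
        using AE_lborel_singleton[of 0] by eventually_elim (use False in \<open>auto simp: indicator_def\<close>)
    qed measurable
    then show ?thesis using False by simp
  qed
  finally have "c * (LINT v:{0..}|lborel. exp (- c * v) * sgn (y - v)) =
      c * (2 * (if y > 0 then (1 - exp (- c * y)) / c else 0) - 1 / c)" by simp
  also have "\<dots> = (if y > 0 then 1 - 2 * exp (- c * y) else -1)"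
    using c by (simp add: field_simps)
  finally show ?thesis .
qed

text \<open>Dominated convergence in the formula through \<open>Si\<close> replaces D by pi sgn. For
  y > 0 this leaves exp(c y) * pi * (1 - (1 - 2 exp(-c y))) = 2 pi; for y < 0 the two terms cancel.
  At y = 0 the same formula would give pi instead.\<close>

lemma perron_kernel_tendsto:
  fixes c y :: real
  assumes c: "c > 0" and y: "y \<noteq> 0"
  shows "((\<lambda>T. perron_kernel c T y) \<longlongrightarrow> of_real (2 * pi * indicator {0..} y)) at_top"
proof -
  obtain B0 where B0: "\<And>z. \<bar>Si z\<bar> \<le> B0" using bounded_Si by blast
  define D where "D = (\<lambda>T z. Si (T * z) - Si (- T * z))"
  have D: "\<bar>D T z\<bar> \<le> 2 * B0" for T z
    unfolding D_def using B0[of "T * z"] B0[of "- T * z"] by linarith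
  have [measurable]: "D T \<in> borel_measurable borel" for T unfolding D_def by measurable
  have lim: "((\<lambda>T. LINT v:{0..}|lborel. exp (- c * v) * D T (y - v)) \<longlongrightarrow>
      (LINT v:{0..}|lborel. exp (- c * v) * (pi * sgn (y - v)))) at_top"
    unfolding set_lebesgue_integral_def
  proof (rule integral_dominated_convergence_at_top)
    show "integrable lborel (\<lambda>v. indicator {0..} v *\<^sub>R (exp (- c * v) * (2 * B0)))"
      using set_integrable_mult_left[OF exp_decay_integrable(1)[OF c], of "2 * B0"]
      by (simp add: set_integrable_def)
    show "\<forall>\<^sub>F T in at_top. AE v in lborel. norm (indicator {0..} v *\<^sub>R (exp (- c * v) * D T (y - v)))
        \<le> indicator {0..} v *\<^sub>R (exp (- c * v) * (2 * B0))"
      using D by (intro always_eventually allI AE_I2) (auto simp: indicator_def abs_mult)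
    show "AE v in lborel. ((\<lambda>T. indicator {0..} v *\<^sub>R (exp (- c * v) * D T (y - v))) \<longlongrightarrow>
        indicator {0..} v *\<^sub>R (exp (- c * v) * (pi * sgn (y - v)))) at_top"
      using AE_lborel_singleton[of y]
    proof eventually_elim
      case (elim v)
      then show ?case
        unfolding D_def by (intro tendsto_scaleR tendsto_mult tendsto_const tendsto_Si_diff_scaled) auto
    qed
  qed measurable
  have "((\<lambda>T. complex_of_real (exp (c * y) * (D T y - c * (LINT v:{0..}|lborel. exp (- c * v) * D T (y - v))))) \<longlongrightarrow>
    of_real (exp (c * y) * (pi * sgn y - c * (LINT v:{0..}|lborel. exp (- c * v) * (pi * sgn (y - v)))))) at_top"
    by (intro tendsto_intros lim) (use tendsto_Si_diff_scaled[OF y] in \<open>simp add: D_def\<close>)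
  also have "exp (c * y) * (pi * sgn y - c * (LINT v:{0..}|lborel. exp (- c * v) * (pi * sgn (y - v)))) =
      2 * pi * indicator {0..} y"
  proof -
    have "c * (LINT v:{0..}|lborel. exp (- c * v) * (pi * sgn (y - v))) =
        pi * (c * (LINT v:{0..}|lborel. exp (- c * v) * sgn (y - v)))"
      by (simp add: mult.left_commute[of _ pi])
    also have "\<dots> = pi * (if y > 0 then 1 - 2 * exp (- c * y) else -1)"
      unfolding set_integral_exp_decay_sgn[OF c] ..
    finally show ?thesis
      using y by (auto simp: algebra_simps exp_minus indicator_def)
  qed
  finally show ?thesis
    by (rule Lim_transform_eventually)
       (use eventually_ge_at_top[of 0] in \<open>eventually_elim, simp add: perron_kernel_eq_Si[OF c] D_def\<close>)
qed

section \<open>Exponentials of shift operators\<close>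

text \<open>In the application \<open>M\<close> is Lebesgue measure on the half-line,
  \<open>b k\<close> is 1/k and \<open>g k x\<close> is k h(x). The condition
  \<open>no_atoms\<close> makes a single exceptional point, such as the jump of the Heaviside
  function, invisible after one application of the operator.\<close>

locale shift_operator = sigma_finite_measure M for M :: "'a measure" +
  fixes I :: "'i set" and b :: "'i \<Rightarrow> real" and g :: "'i \<Rightarrow> 'a \<Rightarrow> real" and c :: real
  assumes fin: "finite I"
    and b_nonneg: "k \<in> I \<Longrightarrow> b k \<ge> 0"
    and g_measurable [measurable]: "k \<in> I \<Longrightarrow> g k \<in> borel_measurable M"
    and exp_integrable: "k \<in> I \<Longrightarrow> integrable M (\<lambda>x. exp (- c * g k x))"
    and no_atoms: "k \<in> I \<Longrightarrow> AE x in M. g k x \<noteq> y"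
    and c_pos: "c > 0"
begin

definition op :: "(real \<Rightarrow> 'b :: {banach, second_countable_topology}) \<Rightarrow> real \<Rightarrow> 'b" where
  "op f y = (\<Sum>k\<in>I. b k *\<^sub>R (\<integral>x. f (y - g k x) \<partial>M))"

definition transform :: "complex \<Rightarrow> complex" where
  "transform s = (\<Sum>k\<in>I. b k *\<^sub>R (\<integral>x. exp (- s * of_real (g k x)) \<partial>M))"

text \<open>The value of \<open>transform\<close> at the real point c; it bounds
  \<open>transform\<close> on the whole line Re s = c.\<close>

definition mass :: real where
  "mass = (\<Sum>k\<in>I. b k * (\<integral>x. exp (- c * g k x) \<partial>M))"

text \<open>The weight exp(c y) is adapted to shifts: replacing y by y - u costs exactly the factor
  exp(-c u). Integrating this factor shows that \<open>op\<close> multiplies the constant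
  \<open>C\<close> by at most \<open>mass\<close>.\<close>

definition tame :: "real \<Rightarrow> (real \<Rightarrow> 'b :: {banach, second_countable_topology}) \<Rightarrow> bool" where
  "tame C f \<longleftrightarrow> f \<in> borel_measurable borel \<and> (\<forall>y. norm (f y) \<le> C * exp (c * y))"

lemma mass_nonneg: "mass \<ge> 0"
  unfolding mass_def by (intro sum_nonneg mult_nonneg_nonneg b_nonneg integral_nonneg_AE) auto

lemma tame_measurable: "tame C f \<Longrightarrow> f \<in> borel_measurable borel"
  by (simp add: tame_def)

lemma tame_bound: "tame C f \<Longrightarrow> norm (f y) \<le> C * exp (c * y)"
  by (simp add: tame_def)

lemma tame_shift_bound: "tame C f \<Longrightarrow> norm (f (y - u)) \<le> C * exp (c * y) * exp (- c * u)"
  using tame_bound[of C f "y - u"] by (simp add: right_diff_distrib exp_diff exp_minus field_simps)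

lemma tame_integrable:
  assumes "tame C f" "k \<in> I"
  shows "integrable M (\<lambda>x. f (y - g k x))"
proof (rule Bochner_Integration.integrable_bound)
  show "integrable M (\<lambda>x. C * exp (c * y) * exp (- c * g k x))"
    by (intro integrable_mult_right exp_integrable assms)
  show "(\<lambda>x. f (y - g k x)) \<in> borel_measurable M"
    using assms by (intro measurable_compose[OF _ tame_measurable[OF assms(1)]]) measurable
  show "AE x in M. norm (f (y - g k x)) \<le> norm (C * exp (c * y) * exp (- c * g k x))"
    using tame_shift_bound[OF assms(1)] by (intro AE_I2) (metis abs_ge_self order.trans real_norm_def)
qed

lemma tame_op:
  assumes "tame C f"
  shows "tame (C * mass) (op f)"
  unfolding tame_def
proof (intro conjI allI)
  have [measurable]: "f \<in> borel_measurable borel" by (rule tame_measurable[OF assms])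
  show "op f \<in> borel_measurable borel"
    unfolding op_def[abs_def]
    by (intro borel_measurable_sum borel_measurable_scaleR borel_measurable_const borel_measurable_lebesgue_integral)
       measurable
  fix y
  have "norm (op f y) \<le> (\<Sum>k\<in>I. norm (b k *\<^sub>R (\<integral>x. f (y - g k x) \<partial>M)))"
    unfolding op_def by (rule norm_sum)
  also have "\<dots> \<le> (\<Sum>k\<in>I. b k * (\<integral>x. C * exp (c * y) * exp (- c * g k x) \<partial>M))"
  proof (rule sum_mono)
    fix k assume k: "k \<in> I"
    have "norm (\<integral>x. f (y - g k x) \<partial>M) \<le> (\<integral>x. C * exp (c * y) * exp (- c * g k x) \<partial>M)"
    proof (rule order.trans[OF integral_norm_bound integral_mono])
      show "integrable M (\<lambda>x. norm (f (y - g k x)))"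
        by (intro integrable_norm tame_integrable[OF assms k])
      show "integrable M (\<lambda>x. C * exp (c * y) * exp (- c * g k x))"
        by (intro integrable_mult_right exp_integrable k)
    qed (rule tame_shift_bound[OF assms])
    then show "norm (b k *\<^sub>R (\<integral>x. f (y - g k x) \<partial>M)) \<le> b k * (\<integral>x. C * exp (c * y) * exp (- c * g k x) \<partial>M)"
      using b_nonneg[OF k] by (simp add: mult_left_mono)
  qed
  also have "\<dots> = C * mass * exp (c * y)"
    unfolding mass_def sum_distrib_left sum_distrib_right by (intro sum.cong) auto
  finally show "norm (op f y) \<le> C * mass * exp (c * y)" .
qed

lemma tame_op_power: "tame C f \<Longrightarrow> tame (C * mass ^ m) ((op ^^ m) f)"
proof (induction m)
  case (Suc m)
  then show ?case using tame_op[of "C * mass ^ m" "(op ^^ m) f"] by (simp add: mult_ac)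
qed simp

lemma op_cmult: "op (\<lambda>y. a * f y) = (\<lambda>y. a * op f y)" for a :: complex
  by (auto simp: op_def sum_distrib_left)

lemma op_power_cmult: "(op ^^ m) (\<lambda>y. a * f y) = (\<lambda>y. a * (op ^^ m) f y)" for a :: complex
  by (induction m) (auto simp: op_cmult)

lemma op_of_real: "op (\<lambda>y. complex_of_real (f y)) = (\<lambda>y. of_real (op f y))"
  by (auto simp: op_def scaleR_conv_of_real)

lemma op_power_of_real: "(op ^^ m) (\<lambda>y. complex_of_real (f y)) = (\<lambda>y. of_real ((op ^^ m) f y))"
  by (induction m) (auto simp: op_of_real)

text \<open>Pointwise convergence off the origin suffices because the shifts have no atoms.\<close>

lemma op_tendsto:
  fixes F :: "real \<Rightarrow> real \<Rightarrow> 'b :: {banach, second_countable_topology}"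
  assumes F: "\<And>T. tame C (F T)" and f: "tame C f"
    and lim: "\<And>y. y \<noteq> 0 \<Longrightarrow> ((\<lambda>T. F T y) \<longlongrightarrow> f y) at_top"
  shows "((\<lambda>T. op (F T) y) \<longlongrightarrow> op f y) at_top"
  unfolding op_def
proof (intro tendsto_sum tendsto_scaleR tendsto_const)
  fix k assume k: "k \<in> I"
  show "((\<lambda>T. \<integral>x. F T (y - g k x) \<partial>M) \<longlongrightarrow> (\<integral>x. f (y - g k x) \<partial>M)) at_top"
  proof (rule integral_dominated_convergence_at_top)
    show "integrable M (\<lambda>x. C * exp (c * y) * exp (- c * g k x))"
      by (intro integrable_mult_right exp_integrable k)
    show "\<forall>\<^sub>F T in at_top. AE x in M. norm (F T (y - g k x)) \<le> C * exp (c * y) * exp (- c * g k x)"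
      using tame_shift_bound[OF F] by (intro always_eventually allI AE_I2) auto
    show "AE x in M. ((\<lambda>T. F T (y - g k x)) \<longlongrightarrow> f (y - g k x)) at_top"
      using no_atoms[OF k, of y] by eventually_elim (auto intro!: lim)
  qed (use tame_integrable[OF F k] tame_integrable[OF f k] in auto)
qed

text \<open>Induction on m with \<open>op_tendsto\<close>. The condition on y serves the base case,
  where convergence at the origin is not assumed.\<close>

lemma op_power_tendsto:
  fixes F :: "real \<Rightarrow> real \<Rightarrow> 'b :: {banach, second_countable_topology}"
  assumes F: "\<And>T. tame C (F T)" and f: "tame C f"
    and lim: "\<And>y. y \<noteq> 0 \<Longrightarrow> ((\<lambda>T. F T y) \<longlongrightarrow> f y) at_top"
    and "y \<noteq> 0"
  shows "((\<lambda>T. (op ^^ m) (F T) y) \<longlongrightarrow> (op ^^ m) f y) at_top"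
  using \<open>y \<noteq> 0\<close>
proof (induction m arbitrary: y)
  case (Suc m)
  then show ?case
    using op_tendsto[OF tame_op_power[OF F] tame_op_power[OF f]] by simp
qed (use lim in simp)

section \<open>The exponential of the operator applied to the Perron kernel\<close>

lemma transform_measurable [measurable]: "(\<lambda>t. transform (Complex c t)) \<in> borel_measurable borel"
  unfolding transform_def Complex_eq
  by (intro borel_measurable_sum borel_measurable_scaleR borel_measurable_const borel_measurable_lebesgue_integral)
     measurable

lemma norm_transform_le: "norm (transform (Complex c t)) \<le> mass"
proof -
  have "norm (transform (Complex c t)) \<le> (\<Sum>k\<in>I. norm (b k *\<^sub>R (\<integral>x. exp (- Complex c t * of_real (g k x)) \<partial>M)))"
    unfolding transform_def by (rule norm_sum)
  also have "\<dots> \<le> mass"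
    unfolding mass_def
  proof (rule sum_mono)
    fix k assume k: "k \<in> I"
    have "norm (\<integral>x. exp (- Complex c t * of_real (g k x)) \<partial>M) \<le> (\<integral>x. norm (exp (- Complex c t * of_real (g k x))) \<partial>M)"
      by (rule integral_norm_bound)
    then show "norm (b k *\<^sub>R (\<integral>x. exp (- Complex c t * of_real (g k x)) \<partial>M)) \<le> b k * (\<integral>x. exp (- c * g k x) \<partial>M)"
      using b_nonneg[OF k] by (simp add: norm_exp_eq_Re mult_left_mono)
  qed
  finally show ?thesis .
qed

text \<open>Exponentials are eigenfunctions: shifting exp(y s) by g k x gives the factor exp(-s g k
  x), and averaging these factors gives \<open>transform s\<close>. Fubini carries this through the
  integral over t, as \<open>r\<close> is bounded and the t-interval is finite.\<close>

lemma op_exp_integral: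
  fixes r :: "real \<Rightarrow> complex"
  assumes [measurable]: "r \<in> borel_measurable borel"
    and bound: "\<And>t. norm (r t) \<le> B"
  shows "op (\<lambda>y. LINT t:{-T..T}|lborel. r t * exp (of_real y * Complex c t)) =
    (\<lambda>y. LINT t:{-T..T}|lborel. r t * transform (Complex c t) * exp (of_real y * Complex c t))"
proof
  fix y
  interpret pair_sigma_finite M lborel ..
  let ?f = "\<lambda>k x t. indicator {-T..T} t *\<^sub>R (r t * exp (of_real (y - g k x) * Complex c t)) :: complex"
  have int: "integrable (M \<Otimes>\<^sub>M lborel) (\<lambda>(x, t). ?f k x t)" if k: "k \<in> I" for k
  proof (rule integrable_pair_bound_product)
    show "integrable M (\<lambda>x. exp (- c * g k x))" by (rule exp_integrable[OF k])
    show "integrable lborel (\<lambda>t. indicator {-T..T} t * (B * exp (c * y)))"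
      by (intro integrable_mult_left) (simp add: integrable_indicator_iff emeasure_lborel_Icc_eq)
    show "(\<lambda>(x, t). ?f k x t) \<in> borel_measurable (M \<Otimes>\<^sub>M lborel)"
      using k unfolding Complex_eq by measurable
    fix x t
    have "norm (r t * exp (of_real (y - g k x) * Complex c t)) \<le> B * exp (c * (y - g k x))"
      using bound[of t] by (simp add: norm_mult norm_exp_eq_Re mult.commute)
    also have "\<dots> = exp (- c * g k x) * (B * exp (c * y))"
      by (simp add: right_diff_distrib exp_diff exp_minus field_simps)
    finally show "norm (case (x, t) of (x, t) \<Rightarrow> ?f k x t) \<le> exp (- c * g k x) * (indicator {-T..T} t * (B * exp (c * y)))"
      by (auto simp: indicator_def)
  qed
  have inner: "(\<integral>x. ?f k x t \<partial>M) =
     indicator {-T..T} t *\<^sub>R (r t * exp (of_real y * Complex c t) * (\<integral>x. exp (- Complex c t * of_real (g k x)) \<partial>M))" for k t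
  proof -
    have "exp (of_real (y - g k x) * Complex c t) = exp (of_real y * Complex c t) * exp (- Complex c t * of_real (g k x))" for x
      by (subst exp_add[symmetric]) (simp add: algebra_simps)
    then show ?thesis by (simp add: mult.assoc)
  qed
  have "op (\<lambda>y. LINT t:{-T..T}|lborel. r t * exp (of_real y * Complex c t)) y =
      (\<Sum>k\<in>I. b k *\<^sub>R (\<integral>x. (\<integral>t. ?f k x t \<partial>lborel) \<partial>M))"
    by (simp add: op_def set_lebesgue_integral_def)
  also have "\<dots> = (\<Sum>k\<in>I. \<integral>t. b k *\<^sub>R (\<integral>x. ?f k x t \<partial>M) \<partial>lborel)"
    by (intro sum.cong refl) (simp only: integral_scaleR_right Fubini_integral[OF int, symmetric])
  also have "\<dots> = (\<integral>t. (\<Sum>k\<in>I. b k *\<^sub>R (\<integral>x. ?f k x t \<partial>M)) \<partial>lborel)"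
    by (intro Bochner_Integration.integral_sum[symmetric] integrable_scaleR_right integrable_snd int)
  also have "\<dots> = (LINT t:{-T..T}|lborel. r t * transform (Complex c t) * exp (of_real y * Complex c t))"
    unfolding inner set_lebesgue_integral_def transform_def
    by (intro Bochner_Integration.integral_cong refl)
       (auto simp: sum_distrib_left sum_distrib_right scaleR_sum_right scaleR_conv_of_real mult_ac)
  finally show "op (\<lambda>y. LINT t:{-T..T}|lborel. r t * exp (of_real y * Complex c t)) y = \<dots>" .
qed

lemma inverse_Complex_measurable [measurable]: "(\<lambda>t. inverse (Complex c t)) \<in> borel_measurable borel"
  unfolding Complex_eq by measurable

lemma norm_inverse_Complex_le: "norm (inverse (Complex c t)) \<le> 1 / c"
  using le_imp_inverse_le[OF complex_Re_le_cmod[of "Complex c t"]] c_pos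
  by (simp add: norm_divide inverse_eq_divide)

lemma op_power_perron_kernel:
  "(op ^^ m) (perron_kernel c T) =
    (\<lambda>y. LINT t:{-T..T}|lborel. inverse (Complex c t) * transform (Complex c t) ^ m * exp (of_real y * Complex c t))"
proof (induction m)
  case 0
  then show ?case by (simp add: perron_kernel_def[abs_def] divide_inverse mult.commute)
next
  case (Suc m)
  have "norm (inverse (Complex c t) * transform (Complex c t) ^ m) \<le> 1 / c * mass ^ m" for t
    unfolding norm_mult norm_power
    by (intro mult_mono power_mono norm_transform_le norm_inverse_Complex_le) (use c_pos in auto)
  then have "op (\<lambda>y. LINT t:{-T..T}|lborel. inverse (Complex c t) * transform (Complex c t) ^ m * exp (of_real y * Complex c t)) =
    (\<lambda>y. LINT t:{-T..T}|lborel. (inverse (Complex c t) * transform (Complex c t) ^ m) * transform (Complex c t) * exp (of_real y * Complex c t))"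
    by (intro op_exp_integral) measurable
  then show ?case using Suc by (simp add: mult_ac)
qed

lemma exp_transform_integrand_measurable [measurable]:
  "(\<lambda>t. inverse (Complex c t) * exp (transform (Complex c t)) * exp (of_real x * Complex c t)) \<in> borel_measurable borel"
proof -
  have "(\<lambda>t. exp (of_real x * Complex c t)) \<in> borel_measurable borel"
    unfolding Complex_eq by measurable
  then show ?thesis by measurable
qed

lemma exp_transform_integrable:
  "set_integrable lborel {-T..T}
     (\<lambda>t. inverse (Complex c t) * exp (transform (Complex c t)) * exp (of_real x * Complex c t))"
  unfolding set_integrable_def
proof (rule Bochner_Integration.integrable_bound)
  show "integrable lborel (\<lambda>t. indicator {-T..T} t * (1 / c * exp mass * exp (c * x)))"
    by (intro integrable_mult_left) (simp add: integrable_indicator_iff emeasure_lborel_Icc_eq)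
  have "norm (inverse (Complex c t) * exp (transform (Complex c t)) * exp (of_real x * Complex c t))
      \<le> 1 / c * exp mass * exp (c * x)" for t
    unfolding norm_mult
  proof (intro mult_mono)
    show "norm (exp (transform (Complex c t))) \<le> exp mass"
      using norm_transform_le[of t] norm_exp[of "transform (Complex c t)"] by (meson exp_le_cancel_iff order.trans)
  qed (use c_pos norm_inverse_Complex_le in \<open>auto simp: mult.commute\<close>)
  then show "AE t in lborel. norm (indicator {-T..T} t *\<^sub>R
        (inverse (Complex c t) * exp (transform (Complex c t)) * exp (of_real x * Complex c t)))
      \<le> norm (indicator {-T..T} t * (1 / c * exp mass * exp (c * x)))"
    using c_pos by (intro AE_I2) (auto simp: indicator_def)
qed measurable

text \<open>The exponential series of \<open>transform\<close> is integrated term by term. On the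
  bounded interval the m-th term is at most a constant times mass^m / m!, because
  \<open>transform\<close> is bounded by \<open>mass\<close> on the line.\<close>

lemma op_power_perron_kernel_sums:
  "(\<lambda>m. (op ^^ m) (perron_kernel c T) x / fact m) sums
    (LINT t:{-T..T}|lborel. inverse (Complex c t) * exp (transform (Complex c t)) * exp (of_real x * Complex c t))"
proof -
  define F where "F m t = indicator {-T..T} t *\<^sub>R
    (inverse (Complex c t) * transform (Complex c t) ^ m * exp (of_real x * Complex c t) / fact m)" for m t
  define K where "K = 1 / c * exp (c * x)"
  have bound: "norm (F m t) \<le> indicator {-T..T} t * (K * (mass ^ m / fact m))" for m t
  proof -
    have "norm (inverse (Complex c t) * transform (Complex c t) ^ m * exp (of_real x * Complex c t))
        \<le> 1 / c * mass ^ m * exp (c * x)"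
      unfolding norm_mult norm_power
      by (intro mult_mono power_mono norm_transform_le norm_inverse_Complex_le)
         (use c_pos mass_nonneg in \<open>auto simp: mult.commute\<close>)
    then have "norm (inverse (Complex c t) * transform (Complex c t) ^ m * exp (of_real x * Complex c t)) / fact m
        \<le> 1 / c * mass ^ m * exp (c * x) / fact m"
      by (rule divide_right_mono) simp
    then show ?thesis
      by (auto simp: F_def K_def indicator_def norm_divide mult_ac)
  qed
  have [measurable]: "F m \<in> borel_measurable borel" for m
  proof -
    have "(\<lambda>t. exp (of_real x * Complex c t)) \<in> borel_measurable borel"
      unfolding Complex_eq by measurable
    then show ?thesis unfolding F_def[abs_def] by measurable
  qed
  have ind: "integrable lborel (\<lambda>t. indicator {-T..T} t * (K * (mass ^ m / fact m)))" for m
    by (intro integrable_mult_left) (simp add: integrable_indicator_iff emeasure_lborel_Icc_eq)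
  have F_int: "integrable lborel (F m)" for m
    by (rule Bochner_Integration.integrable_bound[OF ind[of m]])
       (measurable, intro AE_I2, use order.trans[OF bound abs_ge_self] in simp)
  have summ: "summable (\<lambda>m. mass ^ m / fact m)"
    using summable_exp[of mass] by (simp add: divide_inverse mult.commute)
  have "(\<lambda>m. integral\<^sup>L lborel (F m)) sums (\<integral>t. (\<Sum>m. F m t) \<partial>lborel)"
  proof (rule sums_integral[OF F_int])
    show "AE t in lborel. summable (\<lambda>m. norm (F m t))"
      by (intro AE_I2 summable_comparison_test'[OF summable_mult[OF summable_mult[OF summ]]])
         (use bound in auto)
    show "summable (\<lambda>m. \<integral>t. norm (F m t) \<partial>lborel)"
    proof (rule summable_comparison_test'[OF summable_mult[OF summ, of "(\<integral>t. indicator {-T..T} t \<partial>lborel) * K"]])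
      fix m
      have "(\<integral>t. norm (F m t) \<partial>lborel) \<le> (\<integral>t. indicator {-T..T} t * (K * (mass ^ m / fact m)) \<partial>lborel)"
        by (intro integral_mono integrable_norm F_int ind bound)
      also have "\<dots> = (\<integral>t. indicator {-T..T} t \<partial>lborel) * K * (mass ^ m / fact m)"
        by simp
      finally show "norm (\<integral>t. norm (F m t) \<partial>lborel) \<le> (\<integral>t. indicator {-T..T} t \<partial>lborel) * K * (mass ^ m / fact m)"
        by (simp add: integral_nonneg_AE)
    qed
  qed
  moreover have "integral\<^sup>L lborel (F m) = (op ^^ m) (perron_kernel c T) x / fact m" for m
    unfolding op_power_perron_kernel F_def set_lebesgue_integral_def scaleR_conv_of_real times_divide_eq_right
    by (rule integral_divide_zero)
  moreover have "(\<Sum>m. F m t) = indicator {-T..T} t *\<^sub>R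
      (inverse (Complex c t) * exp (transform (Complex c t)) * exp (of_real x * Complex c t))" for t
  proof -
    have "(\<lambda>m. indicator {-T..T} t *\<^sub>R (inverse (Complex c t) * exp (of_real x * Complex c t) * (transform (Complex c t) ^ m /\<^sub>R fact m)))
      sums (indicator {-T..T} t *\<^sub>R (inverse (Complex c t) * exp (of_real x * Complex c t) * exp (transform (Complex c t))))"
      by (intro sums_scaleR_right sums_mult exp_converges)
    also have "(\<lambda>m. indicator {-T..T} t *\<^sub>R (inverse (Complex c t) * exp (of_real x * Complex c t) * (transform (Complex c t) ^ m /\<^sub>R fact m))) = (\<lambda>m. F m t)"
      by (intro ext) (simp add: F_def scaleR_conv_of_real divide_inverse mult_ac)
    finally show ?thesis by (simp only: sums_iff mult_ac)
  qed
  ultimately show ?thesis by (simp add: set_lebesgue_integral_def)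
qed

lemma tame_mono: "tame C f \<Longrightarrow> C \<le> C' \<Longrightarrow> tame C' f"
  unfolding tame_def by (meson exp_ge_zero mult_right_mono order.trans)

lemma tame_heaviside: "tame 1 (indicator {0..} :: real \<Rightarrow> real)"
  using c_pos by (auto simp: tame_def indicator_def)

lemma heaviside_series_summable:
  "summable (\<lambda>m. (op ^^ m) (indicator {0..} :: real \<Rightarrow> real) x / fact m)"
proof (rule summable_comparison_test')
  show "summable (\<lambda>m. exp (c * x) * (mass ^ m / fact m))"
    using summable_exp[of mass] by (intro summable_mult) (simp add: divide_inverse mult.commute)
  show "norm ((op ^^ m) (indicator {0..} :: real \<Rightarrow> real) x / fact m) \<le> exp (c * x) * (mass ^ m / fact m)" for m
    using divide_right_mono[OF tame_bound[OF tame_op_power[OF tame_heaviside], of m x], of "fact m"]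
    by (simp add: mult.commute)
qed

text \<open>For each m the iterate on the kernel tends to the iterate on 2 pi times the Heaviside
  function. The terms are dominated, uniformly in T, by a multiple of mass^m / m!, so Tannery's
  theorem allows the limit inside the series.\<close>

theorem exp_transform_inversion:
  assumes "x \<noteq> 0"
  shows "((\<lambda>T. LINT t:{-T..T}|lborel. inverse (Complex c t) * exp (transform (Complex c t)) * exp (of_real x * Complex c t))
    \<longlongrightarrow> of_real (2 * pi * (\<Sum>m. (op ^^ m) (indicator {0..}) x / fact m))) at_top"
proof -
  obtain B where B: "\<And>T y. T \<ge> 0 \<Longrightarrow> norm (perron_kernel c T y) \<le> B * exp (c * y)"
    using perron_kernel_bounded[OF c_pos] by blast
  define C where "C = max B (2 * pi)"
  let ?H = "\<lambda>y. complex_of_real (2 * pi) * of_real (indicator {0..} y)"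
  have kernel: "tame B (perron_kernel c T)" for T
    unfolding tame_def
  proof (intro conjI allI)
    show "perron_kernel c T \<in> borel_measurable borel"
      unfolding perron_kernel_def[abs_def] set_lebesgue_integral_def Complex_eq
      by (intro lborel.borel_measurable_lebesgue_integral) measurable
    \<comment> \<open>For T < 0 the interval is empty and the kernel is 0; the bound at T = 0 shows
      that the right-hand side is nonnegative.\<close>
    show "norm (perron_kernel c T y) \<le> B * exp (c * y)" for y
      using B[of T y] order.trans[OF norm_ge_zero B[of 0 y]]
      by (cases "T \<ge> 0") (auto simp: perron_kernel_def set_lebesgue_integral_def)
  qed
  have H: "tame (2 * pi) ?H"
    using tame_heaviside by (auto simp: tame_def norm_mult)
  have terms: "((\<lambda>T. (op ^^ m) (perron_kernel c T) x / fact m) \<longlongrightarrow> (op ^^ m) ?H x / fact m) at_top" for m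
  proof (intro tendsto_divide tendsto_const op_power_tendsto[where C=C])
    show "tame C (perron_kernel c T)" for T by (rule tame_mono[OF kernel]) (simp add: C_def)
    show "tame C ?H" by (rule tame_mono[OF H]) (simp add: C_def)
    show "((\<lambda>T. perron_kernel c T y) \<longlongrightarrow> ?H y) at_top" if "y \<noteq> 0" for y
      using perron_kernel_tendsto[OF c_pos that] by simp
  qed (use assms in auto)
  have "((\<lambda>T. \<Sum>m. (op ^^ m) (perron_kernel c T) x / fact m) \<longlongrightarrow> (\<Sum>m. (op ^^ m) ?H x / fact m)) at_top"
  proof (rule tannerys_theorem[THEN conjunct2, THEN conjunct2, OF terms])
    show "summable (\<lambda>m. B * exp (c * x) * (mass ^ m / fact m))"
      using summable_exp[of mass] by (intro summable_mult) (simp add: divide_inverse mult.commute)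
    show "\<forall>\<^sub>F (m, T) in at_top \<times>\<^sub>F at_top. norm ((op ^^ m) (perron_kernel c T) x / fact m)
        \<le> B * exp (c * x) * (mass ^ m / fact m)"
    proof (intro always_eventually allI)
      fix p :: "nat \<times> real"
      obtain m T where p: "p = (m, T)" by (cases p)
      show "case p of (m, T) \<Rightarrow> norm ((op ^^ m) (perron_kernel c T) x / fact m) \<le> B * exp (c * x) * (mass ^ m / fact m)"
        using divide_right_mono[OF tame_bound[OF tame_op_power[OF kernel], of m T x], of "fact m"]
        by (simp add: p norm_divide mult_ac)
    qed
  qed simp
  moreover have "(\<Sum>m. (op ^^ m) (perron_kernel c T) x / fact m) =
      (LINT t:{-T..T}|lborel. inverse (Complex c t) * exp (transform (Complex c t)) * exp (of_real x * Complex c t))" for T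
    by (rule sums_unique[OF op_power_perron_kernel_sums, symmetric])
  moreover have "(\<Sum>m. (op ^^ m) ?H x / fact m) = of_real (2 * pi * (\<Sum>m. (op ^^ m) (indicator {0..}) x / fact m))"
  proof -
    have "(\<lambda>m. complex_of_real (2 * pi * ((op ^^ m) (indicator {0..}) x / fact m))) sums
        of_real (2 * pi * (\<Sum>m. (op ^^ m) (indicator {0..}) x / fact m))"
      by (intro sums_of_real sums_mult summable_sums heaviside_series_summable)
    then have "(\<lambda>m. (op ^^ m) ?H x / fact m) sums
        of_real (2 * pi * (\<Sum>m. (op ^^ m) (indicator {0..}) x / fact m))"
      unfolding op_power_cmult op_power_of_real by simp
    then show ?thesis by (rule sums_unique[symmetric])
  qed
  ultimately show ?thesis by simp
qed

section \<open>Sign, monotonicity and support of the iterates of the Heaviside function\<close>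

lemma op_nonneg:
  assumes "\<And>y. f y \<ge> (0 :: real)"
  shows "op f y \<ge> 0"
  unfolding op_def by (intro sum_nonneg scaleR_nonneg_nonneg b_nonneg integral_nonneg_AE) (use assms in auto)

lemma op_mono:
  assumes "tame C f" "mono (f :: real \<Rightarrow> real)"
  shows "mono (op f)"
  unfolding op_def
  by (intro monoI sum_mono scaleR_left_mono integral_mono tame_integrable[OF assms(1)] b_nonneg monoD[OF assms(2)]) auto

lemma op_power_heaviside_nonneg: "(op ^^ m) (indicator {0..} :: real \<Rightarrow> real) y \<ge> 0"
  by (induction m arbitrary: y) (auto intro: op_nonneg)

lemma op_power_heaviside_mono: "mono ((op ^^ m) (indicator {0..} :: real \<Rightarrow> real))"
proof (induction m)
  case 0
  show ?case by (auto intro!: monoI simp: indicator_def)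
next
  case (Suc m)
  then show ?case using op_mono[OF tame_op_power[OF tame_heaviside]] by simp
qed

text \<open>Nonnegative shifts only move a negative argument further to the left.\<close>

lemma op_power_heaviside_neg:
  assumes "\<And>k x. k \<in> I \<Longrightarrow> x \<in> space M \<Longrightarrow> g k x \<ge> 0" and "y < 0"
  shows "(op ^^ m) (indicator {0..} :: real \<Rightarrow> real) y = 0"
  using assms(2)
proof (induction m arbitrary: y)
  case (Suc m)
  have "(\<integral>x. (op ^^ m) (indicator {0..}) (y - g k x) \<partial>M) = (\<integral>x. (0::real) \<partial>M)" if "k \<in> I" for k
    by (intro Bochner_Integration.integral_cong refl Suc.IH) (use assms(1)[OF that] Suc.prems in force)
  then show ?case
    by (simp add: op_def[of "(op ^^ m) (indicator {0..})"])
qed simp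

end

section \<open>The generating function modulo a power of X\<close>

text \<open>Truncation at \<open>k \<le> N\<close> of the logarithm of the product of the \<open>(1 - X\<^bsup>a n\<^esup>)\<^sup>-\<^sup>1\<close>, \<open>n \<in> J\<close>.\<close>

definition log_fps :: "nat \<Rightarrow> nat set \<Rightarrow> (nat \<Rightarrow> nat) \<Rightarrow> real fps" where
  "log_fps N J a = (\<Sum>n\<in>J. \<Sum>k=1..N. fps_const (1 / real k) * fps_X ^ (k * a n))"

text \<open>As \<open>l\<close> truncates -log q, the sum q' + q l' should nearly vanish. The
  derivative of \<open>l\<close> is a finite geometric sum, so multiplication by q telescopes and
  leaves the error -a X^(a-1) X^(a N).\<close>

lemma fps_X_power_dvd_log_deriv:
  fixes N a :: nat
  assumes "a > 0"
  defines "q \<equiv> 1 - fps_X ^ a :: real fps"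
    and "l \<equiv> \<Sum>k=1..N. fps_const (1 / real k) * fps_X ^ (k * a) :: real fps"
  shows "fps_X ^ N dvd fps_deriv q + q * fps_deriv l"
proof -
  obtain a' where a': "a = Suc a'" using assms(1) by (cases a) auto
  let ?A = "fps_const (real a) * fps_X ^ a' :: real fps"
  have "fps_deriv l = (\<Sum>k=1..N. ?A * (fps_X ^ a) ^ (k - 1))"
    unfolding l_def fps_deriv_sum
  proof (rule sum.cong)
    fix k assume k: "k \<in> {1..N}"
    then have e: "k * a - 1 = a' + a * (k - 1)"
      by (cases k) (auto simp: a' algebra_simps)
    have "fps_deriv (fps_const (1 / real k) * fps_X ^ (k * a)) =
        (fps_const (1 / real k) * fps_const (real (k * a))) * fps_X ^ (k * a - 1)"
      by (simp only: fps_deriv_mult_const_left fps_deriv_power fps_deriv_fps_X mult_1_right mult.assoc)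
    also have "fps_const (1 / real k) * fps_const (real (k * a)) = fps_const (real a)"
      using k by simp
    also have "fps_const (real a) * fps_X ^ (k * a - 1) = ?A * (fps_X ^ a) ^ (k - 1)"
      unfolding e by (simp add: power_add power_mult mult.assoc)
    finally show "fps_deriv (fps_const (1 / real k) * fps_X ^ (k * a)) = ?A * (fps_X ^ a) ^ (k - 1)" .
  qed simp
  also have "\<dots> = ?A * (\<Sum>j<N. (fps_X ^ a) ^ j)"
    unfolding sum_distrib_left by (rule sum.reindex_bij_witness[of _ Suc "\<lambda>k. k - 1"]) auto
  finally have "q * fps_deriv l = ?A * ((1 - fps_X ^ a) * (\<Sum>j<N. (fps_X ^ a) ^ j))"
    by (simp add: q_def mult_ac)
  also have "\<dots> = ?A * (1 - (fps_X ^ a) ^ N)"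
    by (simp only: one_diff_power_eq)
  finally have "q * fps_deriv l = ?A * (1 - (fps_X ^ a) ^ N)" .
  moreover have "fps_deriv q = - ?A"
  proof -
    have "fps_deriv (fps_X ^ a) = ?A"
      by (simp only: fps_deriv_power fps_deriv_fps_X mult_1_right) (simp add: a')
    then show ?thesis by (simp add: q_def)
  qed
  ultimately have "fps_deriv q + q * fps_deriv l = - ?A * fps_X ^ (a * N)"
    by (simp add: algebra_simps power_mult[symmetric])
  moreover have "fps_X ^ N dvd (fps_X ^ (a * N) :: real fps)"
    using assms(1) by (intro le_imp_power_dvd) simp
  ultimately show ?thesis by simp
qed

text \<open>Logarithmic derivatives add under products: by the product rule, the expression for the
  enlarged set is a combination of the one for J and the one for the new factor.\<close>

lemma fps_X_power_dvd_log_deriv_prod: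
  assumes "finite J" "\<And>n. n \<in> J \<Longrightarrow> a n > 0"
  defines "Q \<equiv> \<lambda>J. \<Prod>n\<in>J. 1 - fps_X ^ a n :: real fps"
  shows "fps_X ^ N dvd fps_deriv (Q J) + Q J * fps_deriv (log_fps N J a)"
  using assms(1,2)
proof (induction J rule: finite_induct)
  case empty
  then show ?case by (simp add: Q_def log_fps_def)
next
  case (insert n J)
  let ?q = "1 - fps_X ^ a n :: real fps"
  let ?l = "\<Sum>k=1..N. fps_const (1 / real k) * fps_X ^ (k * a n) :: real fps"
  have "fps_X ^ N dvd ?q * (fps_deriv (Q J) + Q J * fps_deriv (log_fps N J a)) + Q J * (fps_deriv ?q + ?q * fps_deriv ?l)"
    using insert by (intro dvd_add[OF dvd_mult dvd_mult] fps_X_power_dvd_log_deriv) auto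
  also have "\<dots> = fps_deriv (?q * Q J) + (?q * Q J) * fps_deriv (?l + log_fps N J a)"
    by (simp only: fps_deriv_mult fps_deriv_add) (simp add: algebra_simps)
  also have "?q * Q J = Q (insert n J)" using insert by (simp add: Q_def)
  also have "?l + log_fps N J a = log_fps N (insert n J) a" using insert by (simp add: log_fps_def)
  finally show ?case .
qed

lemma log_fps_nth_0:
  assumes "\<And>n. n \<in> J \<Longrightarrow> a n > 0"
  shows "log_fps N J a $ 0 = 0"
  using assms by (auto simp: log_fps_def fps_sum_nth intro!: sum.neutral)

lemma exp_log_fps_nth:
  assumes J: "finite J" "\<And>n. n \<in> J \<Longrightarrow> a n > 0" and "j \<le> N"
  shows "(fps_exp 1 oo log_fps N J a) $ j = (\<Prod>n\<in>J. inverse (1 - fps_X ^ a n)) $ j"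
proof -
  define L where "L = log_fps N J a"
  define E where "E = fps_exp 1 oo L"
  define Q where "Q = (\<Prod>n\<in>J. 1 - fps_X ^ a n :: real fps)"
  define P where "P = (\<Prod>n\<in>J. inverse (1 - fps_X ^ a n :: real fps))"
  have L0: "L $ 0 = 0" unfolding L_def by (rule log_fps_nth_0) (use J in auto)
  have PQ: "Q * P = 1"
    unfolding P_def Q_def prod.distrib[symmetric]
    by (intro prod.neutral ballI inverse_mult_eq_1') (use J in auto)
  \<comment> \<open>\<open>E * Q\<close> should be \<open>1\<close>; its derivative vanishes to order \<open>N\<close>.\<close>
  have "fps_deriv (E * Q) = E * (fps_deriv Q + Q * fps_deriv L)"
    unfolding E_def by (simp add: fps_compose_deriv[OF L0] algebra_simps)
  then have dvd: "fps_X ^ N dvd fps_deriv (E * Q)"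
    using fps_X_power_dvd_log_deriv_prod[OF J, where N=N] by (simp add: Q_def L_def)
  have D0: "(E * Q) $ 0 = 1"
  proof -
    have "Q $ 0 = 1" using J unfolding Q_def by (induction J rule: finite_induct) auto
    then show ?thesis by (simp add: E_def)
  qed
  have D: "(E * Q - 1) $ i = 0" if "i \<le> N" for i
  proof (cases i)
    case 0
    then show ?thesis using D0 by simp
  next
    case (Suc k)
    \<comment> \<open>Coefficient k of the derivative is k + 1 times coefficient k + 1 of the
      series, so divisibility by X^N controls the coefficients up to and including degree N.\<close>
    obtain R where "fps_deriv (E * Q) = fps_X ^ N * R" using dvd by (auto elim: dvdE)
    then have "fps_deriv (E * Q) $ k = 0" using Suc that by (simp add: fps_X_power_mult_nth)
    then show ?thesis using Suc by (simp add: fps_deriv_nth del: of_nat_Suc fps_deriv_mult)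
  qed
  have "E = E * (Q * P)" using PQ by simp
  also have "\<dots> = P + (E * Q - 1) * P" by (simp add: algebra_simps)
  finally have "E $ j = P $ j + ((E * Q - 1) * P) $ j" by (metis fps_add_nth)
  moreover have "((E * Q - 1) * P) $ j = 0"
    unfolding fps_mult_nth by (intro sum.neutral ballI) (use D \<open>j \<le> N\<close> in auto)
  ultimately show ?thesis by (simp add: E_def L_def P_def)
qed

text \<open>The series 1 / (1 - X); its partial sums over all indices up to n turn cumulative counts
  into single coefficients.\<close>

definition ones_fps :: "real fps" where "ones_fps = Abs_fps (\<lambda>_. 1)"

lemma mult_ones_fps_nth: "(f * ones_fps) $ n = (\<Sum>j=0..n. f $ j)"
  by (simp add: fps_mult_nth ones_fps_def)

lemma fps_power_nth_eq_0:
  fixes L :: "real fps"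
  assumes "L $ 0 = 0" "j < i"
  shows "(L ^ i) $ j = 0"
  using startsby_zero_power_prefix[OF assms(1), of i] assms(2) by auto

text \<open>The power L^m starts at degree m or later, so only m \<le> N contribute and the series
  is a finite sum.\<close>

lemma exp_fps_partial_sums:
  fixes L :: "real fps"
  assumes "L $ 0 = 0"
  shows "(\<lambda>m. (L ^ m * ones_fps) $ N / fact m) sums (\<Sum>j=0..N. (fps_exp 1 oo L) $ j)"
proof -
  have "(\<lambda>m. (L ^ m * ones_fps) $ N / fact m) sums (\<Sum>m\<in>{0..N}. (L ^ m * ones_fps) $ N / fact m)"
    by (rule sums_finite) (auto simp: mult_ones_fps_nth fps_power_nth_eq_0[OF assms] intro!: sum.neutral)
  also have "(\<Sum>m\<in>{0..N}. (L ^ m * ones_fps) $ N / fact m) = (\<Sum>j=0..N. \<Sum>m=0..N. (L ^ m) $ j / fact m)"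
    unfolding mult_ones_fps_nth sum_divide_distrib by (rule sum.swap)
  also have "\<dots> = (\<Sum>j=0..N. (fps_exp 1 oo L) $ j)"
  proof (rule sum.cong)
    fix j assume "j \<in> {0..N}"
    then have "(\<Sum>m=0..N. (L ^ m) $ j / fact m) = (\<Sum>m=0..j. (L ^ m) $ j / fact m)"
      by (intro sum.mono_neutral_right) (auto simp: fps_power_nth_eq_0[OF assms])
    then show "(\<Sum>m=0..N. (L ^ m) $ j / fact m) = (fps_exp 1 oo L) $ j"
      by (simp add: fps_compose_nth)
  qed simp
  finally show ?thesis .
qed

text \<open>This is exp(L + \<eta>) = exp(\<eta>) exp(L) for the N-th coefficient. A constant term
  lets infinitely many powers contribute, so the identity is proved between real series: the
  binomial theorem exhibits the left side as a Cauchy product, and nonnegativity supplies absolute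
  convergence.\<close>

lemma exp_shifted_fps_partial_sums:
  fixes L :: "real fps"
  assumes s: "(\<lambda>m. (L ^ m * ones_fps) $ N / fact m) sums S"
    and nonneg: "\<And>m. (L ^ m * ones_fps) $ N \<ge> 0"
    and "\<eta> \<ge> 0"
  shows "(\<lambda>m. ((L + fps_const \<eta>) ^ m * ones_fps) $ N / fact m) sums (exp \<eta> * S)"
proof -
  define u where "u m = (L ^ m * ones_fps) $ N / fact m" for m
  define v where "v m = \<eta> ^ m / fact m" for m
  have v: "v sums exp \<eta>"
    using exp_converges[of \<eta>] by (simp add: v_def[abs_def] divide_inverse mult.commute)
  have "(\<lambda>m. \<Sum>i\<le>m. u i * v (m - i)) sums ((\<Sum>m. u m) * (\<Sum>m. v m))"
    by (rule Cauchy_product_sums)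
       (use sums_summable[OF s] sums_summable[OF v] nonneg \<open>\<eta> \<ge> 0\<close> in \<open>auto simp: u_def[abs_def] v_def[abs_def]\<close>)
  moreover have "(\<Sum>i\<le>m. u i * v (m - i)) = ((L + fps_const \<eta>) ^ m * ones_fps) $ N / fact m" for m
  proof -
    have "((L + fps_const \<eta>) ^ m * ones_fps) $ N =
        (\<Sum>i\<le>m. (fps_const (real (m choose i) * \<eta> ^ (m - i)) * (L ^ i * ones_fps)) $ N)"
      unfolding binomial_ring sum_distrib_right fps_sum_nth
      by (intro sum.cong refl arg_cong2[where f=fps_nth]) (simp add: fps_of_nat[symmetric] fps_const_power mult_ac fps_const_mult[symmetric] del: fps_const_mult)
    also have "\<dots> = (\<Sum>i\<le>m. real (m choose i) * \<eta> ^ (m - i) * (L ^ i * ones_fps) $ N)"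
      by (simp only: fps_mult_left_const_nth)
    also have "\<dots> / fact m = (\<Sum>i\<le>m. u i * v (m - i))"
      unfolding sum_divide_distrib
      by (intro sum.cong refl) (simp add: u_def v_def binomial_fact)
    finally show ?thesis ..
  qed
  moreover have "(\<Sum>m. u m) = S" "(\<Sum>m. v m) = exp \<eta>"
    using s v by (auto simp: u_def sums_iff)
  ultimately show ?thesis by (simp add: mult.commute)
qed

text \<open>The inductive step is exp(1/(n+1)) * n \<le> n + 1, from 1 - u \<le> exp(-u) at u =
  1/(n+1). Equality holds at N = 1.\<close>

lemma exp_harm_le: "N > 0 \<Longrightarrow> exp (\<Sum>k=1..N. 1 / real k) \<le> exp 1 * real N"
proof (induction N rule: nat_induct_non_zero)
  case (Suc n)
  have "1 - 1 / real (Suc n) \<le> exp (- (1 / real (Suc n)))"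
    using exp_ge_add_one_self[of "- (1 / real (Suc n))"] by simp
  then have "exp (1 / real (Suc n)) * (real n / real (Suc n)) \<le> 1"
    by (simp add: exp_minus field_simps)
  then have "exp (1 / real (Suc n)) * real n \<le> real (Suc n)"
    by (simp add: field_simps)
  then have "exp 1 * (exp (1 / real (Suc n)) * real n) \<le> exp 1 * real (Suc n)"
    by (intro mult_left_mono) auto
  moreover have "exp (\<Sum>k=1..Suc n. 1 / real k) = exp (\<Sum>k=1..n. 1 / real k) * exp (1 / real (Suc n))"
    by (simp add: exp_add)
  moreover have "exp (\<Sum>k=1..n. 1 / real k) * exp (1 / real (Suc n)) \<le> exp 1 * real n * exp (1 / real (Suc n))"
    using Suc.IH by (rule mult_right_mono) simp
  ultimately show ?case by (simp only: mult_ac)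
qed simp

text \<open>Multiplication by \<open>log_fps\<close> is the discrete counterpart of the operator: a
  sum over n stands where \<open>op\<close> integrates over x.\<close>

lemma log_fps_mult_nth:
  "(log_fps N J a * f) $ y =
    (\<Sum>k=1..N. 1 / real k * (\<Sum>n\<in>J. if y < k * a n then 0 else f $ (y - k * a n)))"
proof -
  have "(log_fps N J a * f) $ y = (\<Sum>n\<in>J. \<Sum>k=1..N. (fps_const (1 / real k) * (fps_X ^ (k * a n) * f)) $ y)"
    unfolding log_fps_def sum_distrib_right fps_sum_nth mult.assoc ..
  also have "\<dots> = (\<Sum>k=1..N. \<Sum>n\<in>J. (fps_const (1 / real k) * (fps_X ^ (k * a n) * f)) $ y)"
    by (rule sum.swap)
  finally show ?thesis
    unfolding fps_mult_left_const_nth fps_X_power_mult_nth sum_distrib_left .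
qed

section \<open>Comparison with the partition function\<close>

text \<open>On each unit interval an antimonotone function lies between its values at the right and
  the left endpoint. The lower sum therefore runs over 1..K and the upper one over 0..K-1; the extra
  term n = 0 is the source of \<eta>.\<close>

lemma set_integral_antimono_bounds:
  fixes f :: "real \<Rightarrow> real"
  assumes int: "set_integrable lborel {0..} f"
    and anti: "\<And>x y. 0 \<le> x \<Longrightarrow> x \<le> y \<Longrightarrow> f y \<le> f x"
  shows "(\<Sum>n=1..K. f (real n)) \<le> (LINT x:{0..<real K}|lborel. f x)"
    and "(LINT x:{0..<real K}|lborel. f x) \<le> (\<Sum>n<K. f (real n))"
proof -
  have step: "f (real (Suc n)) \<le> (LINT x:{real n..<real (Suc n)}|lborel. f x) \<and>
      (LINT x:{real n..<real (Suc n)}|lborel. f x) \<le> f (real n)" for n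
  proof -
    have i: "set_integrable lborel {real n..<real (Suc n)} f"
      by (rule set_integrable_subset[OF int]) auto
    have const: "(LINT x:{real n..<real (Suc n)}|lborel. a) = a" "set_integrable lborel {real n..<real (Suc n)} (\<lambda>_. a)" for a :: real
      by (auto simp: set_lebesgue_integral_def set_integrable_def integrable_indicator_iff)
    have "(LINT x:{real n..<real (Suc n)}|lborel. f (real (Suc n))) \<le> (LINT x:{real n..<real (Suc n)}|lborel. f x)"
      by (rule set_integral_mono[OF const(2) i]) (auto intro: anti)
    moreover have "(LINT x:{real n..<real (Suc n)}|lborel. f x) \<le> (LINT x:{real n..<real (Suc n)}|lborel. f (real n))"
      by (rule set_integral_mono[OF i const(2)]) (auto intro: anti)
    ultimately show ?thesis by (simp only: const(1))
  qed
  have split: "(LINT x:{0..<real (Suc K)}|lborel. f x) =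
      (LINT x:{0..<real K}|lborel. f x) + (LINT x:{real K..<real (Suc K)}|lborel. f x)" for K
  proof -
    have "{0..<real (Suc K)} = {0..<real K} \<union> {real K..<real (Suc K)}" by auto
    then show ?thesis
      by (simp only:) (rule set_integral_Un, auto intro!: set_integrable_subset[OF int])
  qed
  show "(\<Sum>n=1..K. f (real n)) \<le> (LINT x:{0..<real K}|lborel. f x)"
  proof (induction K)
    case (Suc K)
    then show ?case using step[of K] unfolding split by simp
  qed (simp add: set_lebesgue_integral_def)
  show "(LINT x:{0..<real K}|lborel. f x) \<le> (\<Sum>n<K. f (real n))"
  proof (induction K)
    case (Suc K)
    then show ?case using step[of K] unfolding split by simp
  qed (simp add: set_lebesgue_integral_def)
qed

text \<open>The substitution t = 2 T u - T matches the unit-interval parametrisation of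
  \<open>linepath\<close>; the factor i is ds/dt.\<close>

lemma contour_integral_vertical_segment:
  assumes "T > 0" and int: "set_integrable lborel {-T..T} (\<lambda>t. f (Complex c t))"
  shows "contour_integral (linepath (Complex c (-T)) (Complex c T)) f = \<i> * (LINT t:{-T..T}|lborel. f (Complex c t))"
proof -
  have "((\<lambda>t. f (Complex c t)) has_integral (LINT t:{-T..T}|lborel. f (Complex c t))) (cbox (-T) T)"
    using set_borel_integral_eq_integral[OF int] by (simp add: has_integral_iff)
  note * = has_integral_affinity[OF this, of "2 * T" "- T"]
  have "((\<lambda>u. f (Complex c (2 * T * u - T))) has_integral (1 / (2 * T)) *\<^sub>R (LINT t:{-T..T}|lborel. f (Complex c t))) {0..1}"
  proof -
    have "(\<lambda>x. (1 / (2 * T)) *\<^sub>R x + - ((1 / (2 * T)) *\<^sub>R (- T))) ` cbox (- T) T = {0..1}"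
      using assms(1) by (subst image_affinity_cbox) (auto simp: field_simps)
    then show ?thesis
      using * assms(1) by simp
  qed
  then have "((\<lambda>u. f (Complex c (2 * T * u - T)) * (2 * of_real T * \<i>)) has_integral
      (1 / (2 * T)) *\<^sub>R (LINT t:{-T..T}|lborel. f (Complex c t)) * (2 * of_real T * \<i>)) {0..1}"
    by (rule has_integral_mult_left)
  also have "(1 / (2 * T)) *\<^sub>R (LINT t:{-T..T}|lborel. f (Complex c t)) * (2 * of_real T * \<i>) =
      \<i> * (LINT t:{-T..T}|lborel. f (Complex c t))"
    using assms(1) by (simp add: scaleR_conv_of_real)
  also have "(\<lambda>u. f (Complex c (2 * T * u - T)) * (2 * of_real T * \<i>)) =
      (\<lambda>u. f (linepath (Complex c (-T)) (Complex c T) u) * (Complex c T - Complex c (-T)))"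
  proof
    fix u
    have "linepath (Complex c (-T)) (Complex c T) u = Complex c (2 * T * u - T)"
      by (simp add: linepath_def complex_eq_iff algebra_simps)
    moreover have "Complex c T - Complex c (-T) = 2 * of_real T * \<i>"
      by (simp add: complex_eq_iff)
    ultimately show "f (Complex c (2 * T * u - T)) * (2 * of_real T * \<i>) =
       f (linepath (Complex c (-T)) (Complex c T) u) * (Complex c T - Complex c (-T))" by simp
  qed
  finally show ?thesis
    by (intro contour_integral_unique) (simp add: has_contour_integral_linepath)
qed

locale partition_base =
  fixes h :: "real \<Rightarrow> real" and N :: nat and c :: real
  assumes h_mono: "strict_mono_on {0..} h" and h_0: "h 0 = 0"
    and h_int: "\<And>n::nat. h (real n) \<in> \<int>"
    and N_pos: "N > 0" and c_pos': "c > 0"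
begin

lemma h_le: "0 \<le> x \<Longrightarrow> x \<le> y \<Longrightarrow> h x \<le> h y"
  using strict_mono_onD[OF h_mono, of x y] by (cases "x = y") auto

lemma h_nonneg: "0 \<le> x \<Longrightarrow> h x \<ge> 0"
  using h_le[of 0 x] h_0 by simp

lemma h_nat_ge: "h (real n) \<ge> real n"
proof (induction n)
  case (Suc n)
  have "h (real n) < h (real (Suc n))"
    using strict_mono_onD[OF h_mono, of "real n" "real (Suc n)"] by simp
  moreover obtain i j where "h (real n) = of_int i" "h (real (Suc n)) = of_int j"
    using h_int[of n] h_int[of "Suc n"] by (auto elim!: Ints_cases)
  ultimately have "h (real (Suc n)) \<ge> h (real n) + 1" by simp
  then show ?case using Suc by simp
qed (simp add: h_0)

text \<open>Monotonicity compares h(x) with h at the floor of x. This linear growth is what makes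
  exp(-c k h(x)) integrable.\<close>

lemma h_ge:
  assumes "0 \<le> x"
  shows "h x \<ge> x - 1"
proof -
  have "real (nat \<lfloor>x\<rfloor>) \<le> x" "x - 1 \<le> real (nat \<lfloor>x\<rfloor>)" using assms by linarith+
  then show ?thesis using h_nat_ge[of "nat \<lfloor>x\<rfloor>"] h_le[of "real (nat \<lfloor>x\<rfloor>)" x] by linarith
qed

text \<open>Measurability comes from monotonicity and integrability from linear growth. Injectivity
  makes each level set of k h at most one point, hence a null set.\<close>

sublocale shift_operator "restrict_space lborel {0..}" "{1..N}" "\<lambda>k. 1 / real k" "\<lambda>k x. real k * h x" c
proof -
  interpret sigma_finite_measure "restrict_space lborel {0..} :: real measure"
    by (rule sigma_finite_measure_restrict_space[OF sigma_finite_lborel]) simp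
  show "shift_operator (restrict_space lborel {0..}) {1..N} (\<lambda>k. 1 / real k) (\<lambda>k x. real k * h x) c"
  proof
    have "h \<in> borel_measurable (restrict_space borel {0..})"
      by (rule borel_measurable_mono_on_fnc) (auto intro!: mono_onI h_le)
    then have [measurable]: "h \<in> borel_measurable (restrict_space lborel {0..})"
      by (simp cong: measurable_cong_sets add: sets_restrict_space_cong[OF sets_lborel])
    fix k assume k: "k \<in> {1..N}"
    show meas: "(\<lambda>x. real k * h x) \<in> borel_measurable (restrict_space lborel {0..})" by measurable
    show "integrable (restrict_space lborel {0..}) (\<lambda>x. exp (- c * (real k * h x)))"
    proof (rule Bochner_Integration.integrable_bound)
      show "integrable (restrict_space lborel {0..}) (\<lambda>x. exp (c * real k) * exp (- (c * real k) * x))"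
        using exp_decay_integrable(1)[of "c * real k"] c_pos' k
        by (intro integrable_mult_right) (simp add: integrable_restrict_space set_integrable_def)
      show "AE x in restrict_space lborel {0..}. norm (exp (- c * (real k * h x))) \<le> norm (exp (c * real k) * exp (- (c * real k) * x))"
      proof (rule AE_I2)
        fix x assume "x \<in> space (restrict_space lborel {0..} :: real measure)"
        then have "x - 1 \<le> h x" by (intro h_ge) (simp add: space_restrict_space)
        then have "(c * real k) * (x - 1) \<le> (c * real k) * h x"
          using c_pos' by (intro mult_left_mono) auto
        then show "norm (exp (- c * (real k * h x))) \<le> norm (exp (c * real k) * exp (- (c * real k) * x))"
          by (simp add: exp_add[symmetric] algebra_simps)
      qed
    qed measurable
    fix y
    have "AE x in lborel. x \<in> {0..} \<longrightarrow> real k * h x \<noteq> y"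
    proof (cases "\<exists>x0\<ge>0. real k * h x0 = y")
      case True
      then obtain x0 where x0: "x0 \<ge> 0" "real k * h x0 = y" by blast
      have "h x \<noteq> h x0" if "x \<ge> 0" "x \<noteq> x0" for x
        using strict_mono_onD[OF h_mono, of x x0] strict_mono_onD[OF h_mono, of x0 x] that x0(1)
        by (cases "x < x0") auto
      then show ?thesis
        using AE_lborel_singleton[of x0] x0 k by (auto elim!: eventually_mono)
    qed (auto intro!: AE_I2)
    then show "AE x in restrict_space lborel {0..}. real k * h x \<noteq> y"
      by (subst AE_restrict_space_iff) auto
  qed (use c_pos' in auto)
qed

lemma transform_eq_lam: "transform s = lam h N s"
  unfolding transform_def lam_def w'_def
  by (intro sum.cong refl)
     (simp add: integral_restrict_space set_lebesgue_integral_def scaleR_conv_of_real mult_ac)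

definition heaviside_power :: "nat \<Rightarrow> real \<Rightarrow> real" where
  "heaviside_power m = (op ^^ m) (indicator {0..})"

lemma heaviside_power_0: "heaviside_power 0 = indicator {0..}"
  by (simp only: heaviside_power_def funpow_0)

text \<open>This is exp A applied to the Heaviside function. It equals \<phi> off the origin, and as
  a series of real numbers it shows that \<phi> is real.\<close>

definition count :: "real \<Rightarrow> real" where
  "count x = (\<Sum>m. heaviside_power m x / fact m)"

lemma vertical_integral_tendsto:
  assumes "x \<noteq> 0"
  shows "((\<lambda>T. vertical_integral h N c x T) \<longlongrightarrow> \<i> * of_real (2 * pi * count x)) at_top"
proof -
  have "((\<lambda>T. \<i> * (LINT t:{-T..T}|lborel. inverse (Complex c t) * exp (transform (Complex c t)) * exp (of_real x * Complex c t)))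
      \<longlongrightarrow> \<i> * of_real (2 * pi * count x)) at_top"
    unfolding count_def heaviside_power_def by (intro tendsto_mult tendsto_const exp_transform_inversion assms)
  then show ?thesis
  proof (rule Lim_transform_eventually)
    show "\<forall>\<^sub>F T in at_top. \<i> * (LINT t:{-T..T}|lborel. inverse (Complex c t) * exp (transform (Complex c t)) * exp (of_real x * Complex c t))
       = vertical_integral h N c x T"
      using eventually_gt_at_top[of 0]
    proof eventually_elim
      case (elim T)
      note int = exp_transform_integrable[of T x, unfolded transform_eq_lam inverse_eq_divide]
      show ?case
        unfolding vertical_integral_def transform_eq_lam inverse_eq_divide
        by (rule contour_integral_vertical_segment[OF elim, symmetric,
              of "\<lambda>s. 1 / s * exp (lam h N s) * exp (of_real x * s)", OF int])
    qed
  qed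
qed

lemma phi_h_eq_count: "x \<noteq> 0 \<Longrightarrow> phi_h h N c x = of_real (count x)"
  using tendsto_Lim[OF _ vertical_integral_tendsto] by (simp add: phi_h_def)

section \<open>The parts h(n) as natural numbers\<close>

definition part :: "nat \<Rightarrow> nat" where "part n = nat \<lfloor>h (real n)\<rfloor>"

lemma real_part: "real (part n) = h (real n)"
  using h_int[of n] h_nonneg[of "real n"] by (auto simp: part_def elim!: Ints_cases)

lemma part_pos: "n > 0 \<Longrightarrow> part n > 0"
  using h_nat_ge[of n] real_part[of n] by linarith

text \<open>Convergence of formal power series makes each coefficient eventually constant, and
  finitely many coefficients stabilise at a common K. The condition K \<ge> N later ensures that no
  relevant part is cut off.\<close>

lemma p_h_eq_partial_product:
  obtains K where "K \<ge> N" "\<And>j. j \<le> N \<Longrightarrow> p_h h j = (\<Prod>n\<in>{1..K}. inverse (1 - fps_X ^ part n)) $ j"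
proof -
  have "(\<lambda>m. \<Prod>n<m. inverse (1 - fps_X ^ part (Suc n))) \<longlonglongrightarrow> partition_fps h"
    using has_prod_imp_tendsto'[OF has_prod_partition_fps[OF h_mono h_0 h_int]] by (simp add: part_def)
  then have "\<forall>\<^sub>F m in sequentially. \<forall>j\<in>{..N}. (\<Prod>n<m. inverse (1 - fps_X ^ part (Suc n))) $ j = partition_fps h $ j"
    by (intro eventually_ball_finite) (auto simp: tendsto_fps_iff)
  then have "\<forall>\<^sub>F m in sequentially. m \<ge> N \<and> (\<forall>j\<in>{..N}. (\<Prod>n<m. inverse (1 - fps_X ^ part (Suc n))) $ j = partition_fps h $ j)"
    using eventually_ge_at_top by (rule eventually_conj[rotated])
  then obtain K where K: "K \<ge> N" "\<forall>j\<in>{..N}. (\<Prod>n<K. inverse (1 - fps_X ^ part (Suc n))) $ j = partition_fps h $ j"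
    using eventually_happens'[OF sequentially_bot] by blast
  moreover have "(\<Prod>n<K. inverse (1 - fps_X ^ part (Suc n))) = (\<Prod>n\<in>{1..K}. inverse (1 - fps_X ^ part n) :: real fps)"
    by (rule prod.reindex_bij_witness[of _ "\<lambda>k. k - 1" Suc]) auto
  ultimately show thesis by (intro that[of K]) (auto simp: p_h_def)
qed

section \<open>Comparing iterates on the Heaviside function with powers of
  \<open>log_fps\<close>\<close>

lemma tame_heaviside_power: "tame (1 * mass ^ m) (heaviside_power m)"
  unfolding heaviside_power_def by (rule tame_op_power[OF tame_heaviside])

lemma heaviside_power_integrable:
  "k \<in> {1..N} \<Longrightarrow> set_integrable lborel {0..} (\<lambda>x. heaviside_power m (y - real k * h x))"
  using tame_integrable[OF tame_heaviside_power] by (simp add: integrable_restrict_space set_integrable_def)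

lemma heaviside_power_antimono:
  "0 \<le> u \<Longrightarrow> u \<le> v \<Longrightarrow> heaviside_power m (y - real k * h v) \<le> heaviside_power m (y - real k * h u)"
  unfolding heaviside_power_def
  by (intro monoD[OF op_power_heaviside_mono] diff_left_mono mult_left_mono h_le) auto

lemma heaviside_power_nonneg: "heaviside_power m y \<ge> 0"
  unfolding heaviside_power_def by (rule op_power_heaviside_nonneg)

lemma heaviside_power_neg: "y < 0 \<Longrightarrow> heaviside_power m y = 0"
  unfolding heaviside_power_def
  by (rule op_power_heaviside_neg) (auto simp: space_restrict_space intro!: mult_nonneg_nonneg h_nonneg)

lemma heaviside_power_Suc:
  "heaviside_power (Suc m) y = (\<Sum>k=1..N. 1 / real k * (LINT x:{0..}|lborel. heaviside_power m (y - real k * h x)))"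
proof -
  have "heaviside_power (Suc m) y = op (heaviside_power m) y"
    by (simp only: heaviside_power_def funpow.simps o_apply)
  then show ?thesis
    unfolding op_def by (simp add: integral_restrict_space set_lebesgue_integral_def)
qed

text \<open>Vanishing on the negative axis replaces the real shift by subtraction of naturals with a
  case split, the form of the terms in \<open>log_fps_mult_nth\<close>.\<close>

lemma heaviside_power_shift:
  "heaviside_power m (real y - real k * h (real n)) =
    (if y < k * part n then 0 else heaviside_power m (real (y - k * part n)))"
proof -
  have eq: "real k * h (real n) = real (k * part n)" by (simp add: real_part)
  show ?thesis
  proof (cases "y < k * part n")
    case True
    then have "real y - real (k * part n) < 0" by linarith
    then show ?thesis unfolding eq using True by (simp only: heaviside_power_neg if_True)
  next
    case False
    then have "real (y - k * part n) = real y - real (k * part n)"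
      by (simp only: not_less of_nat_diff)
    then show ?thesis unfolding eq using False by (simp only: if_False)
  qed
qed

lemma log_fps_power_nonneg: "(log_fps N J part ^ m * ones_fps) $ y \<ge> 0"
proof (induction m arbitrary: y)
  case (Suc m)
  then show ?case
    unfolding power_Suc mult.assoc log_fps_mult_nth
    by (intro sum_nonneg mult_nonneg_nonneg) auto
qed (simp add: ones_fps_def)

text \<open>Both sides obey parallel recursions in m. The discrete sum over 1..K is a right-endpoint
  sum of the antimonotone integrand, and discarding the range beyond K only decreases the
  nonnegative integral.\<close>

lemma log_fps_power_le_heaviside_power:
  "(log_fps N {1..K} part ^ m * ones_fps) $ y \<le> heaviside_power m (real y)"
proof (induction m arbitrary: y)
  case (Suc m)
  have "(\<Sum>n\<in>{1..K}. if y < k * part n then 0 else (log_fps N {1..K} part ^ m * ones_fps) $ (y - k * part n))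
      \<le> (LINT x:{0..}|lborel. heaviside_power m (real y - real k * h x))" if k: "k \<in> {1..N}" for k
  proof -
    let ?f = "\<lambda>x. heaviside_power m (real y - real k * h x)"
    have "(\<Sum>n\<in>{1..K}. if y < k * part n then 0 else (log_fps N {1..K} part ^ m * ones_fps) $ (y - k * part n))
        \<le> (\<Sum>n=1..K. ?f (real n))"
      unfolding heaviside_power_shift
    proof (rule sum_mono)
      show "(if y < k * part n then 0 else (log_fps N {1..K} part ^ m * ones_fps) $ (y - k * part n)) \<le>
          (if y < k * part n then 0 else heaviside_power m (real (y - k * part n)))" for n
        using Suc.IH[of "y - k * part n"] by (cases "y < k * part n") (simp_all only: if_True if_False order.refl)
    qed
    also have "\<dots> \<le> (LINT x:{0..<real K}|lborel. ?f x)"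
      by (rule set_integral_antimono_bounds(1)[OF heaviside_power_integrable[OF k] heaviside_power_antimono])
    also have "\<dots> \<le> (LINT x:{0..}|lborel. ?f x)"
    proof -
      have int: "set_integrable lborel {0..} ?f" "set_integrable lborel {0..<real K} ?f"
        using heaviside_power_integrable[OF k, of m "real y"]
        by (auto intro: set_integrable_subset[where A="{0..}"])
      show ?thesis
        using int unfolding set_lebesgue_integral_def set_integrable_def
        by (intro integral_mono) (auto simp: indicator_def heaviside_power_nonneg)
    qed
    finally show ?thesis .
  qed
  then show ?case
    unfolding power_Suc mult.assoc log_fps_mult_nth heaviside_power_Suc
    by (intro sum_mono mult_left_mono) auto
qed (simp add: ones_fps_def heaviside_power_0)

text \<open>The same recursion with left-endpoint sums. Since h(0) = 0, the term n = 0 does not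
  shift the argument; weighted by 1/k it adds up to \<eta> times the previous iterate. For x \<ge> K
  + 1 the shift exceeds N \<ge> y, so the indices 0..K suffice.\<close>

lemma heaviside_power_le_log_fps_power:
  assumes "K \<ge> N" "y \<le> N"
  shows "heaviside_power m (real y) \<le>
    ((log_fps N {1..K} part + fps_const (\<Sum>k=1..N. 1 / real k)) ^ m * ones_fps) $ y"
  using assms(2)
proof (induction m arbitrary: y)
  case (Suc m)
  define \<eta> where "\<eta> = (\<Sum>k=1..N. 1 / real k)"
  define R where "R = (log_fps N {1..K} part + fps_const \<eta>) ^ m * ones_fps"
  have IH: "heaviside_power m (real j) \<le> R $ j" if "j \<le> N" for j
    unfolding R_def \<eta>_def by (rule Suc.IH[OF that])
  have bound: "(LINT x:{0..}|lborel. heaviside_power m (real y - real k * h x)) \<le>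
      R $ y + (\<Sum>n\<in>{1..K}. if y < k * part n then 0 else R $ (y - k * part n))" if k: "k \<in> {1..N}" for k
  proof -
    let ?f = "\<lambda>x. heaviside_power m (real y - real k * h x)"
    have "?f x = 0" if "x \<ge> real (Suc K)" for x
    proof (rule heaviside_power_neg)
      have "real (Suc K) \<le> h x"
        using h_nat_ge[of "Suc K"] h_le[of "real (Suc K)" x] that by linarith
      also have "h x \<le> real k * h x"
        using k h_nonneg[of x] that mult_right_mono[of 1 "real k" "h x"] by simp
      finally show "real y - real k * h x < 0" using Suc.prems assms(1) by linarith
    qed
    then have "(LINT x:{0..}|lborel. ?f x) = (LINT x:{0..<real (Suc K)}|lborel. ?f x)"
      unfolding set_lebesgue_integral_def
      by (intro Bochner_Integration.integral_cong) (auto simp: indicator_def)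
    also have "\<dots> \<le> (\<Sum>n<Suc K. ?f (real n))"
      by (rule set_integral_antimono_bounds(2)[OF heaviside_power_integrable[OF k] heaviside_power_antimono])
    also have "\<dots> = ?f 0 + (\<Sum>n\<in>{1..K}. ?f (real n))"
      by (subst sum.lessThan_Suc_shift, simp, rule sum.reindex_bij_witness[of _ "\<lambda>k. k - 1" Suc]) auto
    also have "\<dots> \<le> R $ y + (\<Sum>n\<in>{1..K}. if y < k * part n then 0 else R $ (y - k * part n))"
    proof (intro add_mono sum_mono)
      show "?f 0 \<le> R $ y" using IH[OF Suc.prems] by (simp add: h_0)
      show "?f (real n) \<le> (if y < k * part n then 0 else R $ (y - k * part n))" for n
        unfolding heaviside_power_shift
        using IH[OF order.trans[OF diff_le_self Suc.prems], of "k * part n"]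
        by (cases "y < k * part n") (simp_all only: if_True if_False order.refl)
    qed
    finally show ?thesis .
  qed
  have "heaviside_power (Suc m) (real y) \<le>
      (\<Sum>k=1..N. 1 / real k * (R $ y + (\<Sum>n\<in>{1..K}. if y < k * part n then 0 else R $ (y - k * part n))))"
    unfolding heaviside_power_Suc by (intro sum_mono mult_left_mono bound) auto
  also have "\<dots> = \<eta> * R $ y + (log_fps N {1..K} part * R) $ y"
    unfolding log_fps_mult_nth distrib_left sum.distrib \<eta>_def sum_distrib_right ..
  also have "\<dots> = ((log_fps N {1..K} part + fps_const \<eta>) ^ Suc m * ones_fps) $ y"
    by (simp add: R_def mult.assoc distrib_right)
  finally show ?case unfolding \<eta>_def .
qed (simp add: ones_fps_def heaviside_power_0)

text \<open>The two comparisons for fixed m are divided by m! and summed. The lower series sums to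
  the cumulative partition count, the upper one to exp(\<eta>) times it, and exp(\<eta>) \<le> e
  N.\<close>

lemma count_bounds:
  shows "(\<Sum>n=0..N. p_h h n) \<le> count (real N)"
    and "count (real N) \<le> exp 1 * real N * (\<Sum>n=0..N. p_h h n)"
proof -
  obtain K where K: "K \<ge> N" "\<And>j. j \<le> N \<Longrightarrow> p_h h j = (\<Prod>n\<in>{1..K}. inverse (1 - fps_X ^ part n)) $ j"
    using p_h_eq_partial_product by blast
  define L where "L = log_fps N {1..K} part"
  define S where "S = (\<Sum>n=0..N. p_h h n)"
  have "S = (\<Sum>j=0..N. (fps_exp 1 oo L) $ j)"
    unfolding S_def L_def
  proof (rule sum.cong)
    show "p_h h j = (fps_exp 1 oo log_fps N {1..K} part) $ j" if "j \<in> {0..N}" for j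
      using exp_log_fps_nth[of "{1..K}" part j N] K(2)[of j] that part_pos by simp
  qed simp
  moreover have "L $ 0 = 0"
    unfolding L_def by (rule log_fps_nth_0) (auto intro: part_pos)
  ultimately have L: "(\<lambda>m. (L ^ m * ones_fps) $ N / fact m) sums S"
    using exp_fps_partial_sums by metis
  have C: "(\<lambda>m. heaviside_power m (real N) / fact m) sums count (real N)"
    unfolding count_def heaviside_power_def by (rule summable_sums[OF heaviside_series_summable])
  show "S \<le> count (real N)"
    by (rule sums_le[OF _ L C]) (unfold L_def, intro divide_right_mono log_fps_power_le_heaviside_power, simp)
  define \<eta> where "\<eta> = (\<Sum>k=1..N. 1 / real k)"
  have "\<eta> \<ge> 0" unfolding \<eta>_def by (intro sum_nonneg) auto
  then have E: "(\<lambda>m. ((L + fps_const \<eta>) ^ m * ones_fps) $ N / fact m) sums (exp \<eta> * S)"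
    by (intro exp_shifted_fps_partial_sums L) (auto simp: L_def log_fps_power_nonneg)
  have "count (real N) \<le> exp \<eta> * S"
    by (rule sums_le[OF _ C E])
       (unfold L_def \<eta>_def, intro divide_right_mono heaviside_power_le_log_fps_power K(1), simp_all)
  also have "\<dots> \<le> exp 1 * real N * S"
  proof (rule mult_right_mono)
    show "exp \<eta> \<le> exp 1 * real N" unfolding \<eta>_def by (rule exp_harm_le[OF N_pos])
    show "S \<ge> 0" by (rule sums_le[OF _ sums_zero L]) (auto simp: L_def log_fps_power_nonneg)
  qed
  finally show "count (real N) \<le> exp 1 * real N * S" .
qed

end

theorem theoremA:
  fixes h :: "real \<Rightarrow> real" and N :: nat and c :: real
  assumes "h \<in> {0..} \<rightarrow> {0..}"
    and "strict_mono_on {0..} h"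
    and "h 0 = 0"
    and "\<And>n::nat. h (real n) \<in> \<int>"
    and "N > 0"
    and "c > 0"
    and "\<exists>\<alpha> D :: real. \<alpha> > 0 \<and> D > 0 \<and>
           (\<forall>s. Re s = c \<longrightarrow> norm (w' h 1 s) \<le> D * norm s powr (- \<alpha>))"
  shows "(\<forall>x>0. (\<exists>l. ((\<lambda>T. vertical_integral h N c x T) \<longlongrightarrow> l) at_top) \<and>
                 phi_h h N c x \<in> \<real>) \<and>
         exp (- 1) * (1 / real N) * Re (phi_h h N c (real N)) \<le> (\<Sum>n=0..N. p_h h n) \<and>
         (\<Sum>n=0..N. p_h h n) \<le> Re (phi_h h N c (real N))"
proof -
  interpret partition_base h N c by unfold_locales (use assms in auto)
  have phi: "phi_h h N c (real N) = of_real (count (real N))"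
    using N_pos by (intro phi_h_eq_count) simp
  have "exp (- 1) * (1 / real N) * count (real N) \<le>
      exp (- 1) * (1 / real N) * (exp 1 * real N * (\<Sum>n=0..N. p_h h n))"
    by (intro mult_left_mono count_bounds) auto
  also have "\<dots> = (\<Sum>n=0..N. p_h h n)"
    using N_pos by (simp add: exp_minus)
  finally have "exp (- 1) * (1 / real N) * count (real N) \<le> (\<Sum>n=0..N. p_h h n)" .
  moreover have "(\<exists>l. ((\<lambda>T. vertical_integral h N c x T) \<longlongrightarrow> l) at_top) \<and> phi_h h N c x \<in> \<real>" if "x > 0" for x
    using vertical_integral_tendsto[of x] phi_h_eq_count[of x] that by (metis Reals_of_real less_irrefl)
  ultimately show ?thesis
    using count_bounds(1) by (simp only: phi Re_complex_of_real) blast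
qed

end
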